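(* The variant of BMST in which both the leader and the follower have bottleneck objectives and the pessimistic setting is assumed can be solved exactly in polynomial time. This holds for either version of the follower's bottleneck objective ($\max_{e\in Y}d(e)$ or $\max_{e\in X\cup Y}d(e)$).
   Context: Setting: a finite connected undirected graph $G=(V,E)$, possibly with parallel edges, with $E$ partitioned into disjoint sets $E^\ell$ (leader's edges) and $E^f$ (follower's edges), and cost functions $c,d\colon E\to\mathbb{R}_{\ge 0}$ (leader's and follower's). A leader's choice is a cycle-free $X\subseteq E^\ell$, feasible if $(V,X\cup E^f)$ is connected. Given feasible $X$, the follower chooses $Y\subseteq E^f$ such that $X\cup Y$ is a spanning tree of $G$, minimizing his bottleneck objective, which is either $\max_{e\in Y}d(e)$ or $\max_{e\in X\cup Y}d(e)$ (two versions). The leader's objective is the bottleneck $\max_{e\in X\cup Y}c(e)$, which she minimizes over feasible $X$. Pessimistic setting: if the follower has several optimal responses, he chooses one maximizing the leader's objective. *)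

theory Defs
  imports "HOL-Computational_Algebra.Polynomial"
begin

section \<open>Bilevel minimum spanning trees with bottleneck objectives\<close>

text \<open>Edges have their own type, so parallel edges are allowed.\<close>

record ('v, 'e) bmst =
  verts :: "'v set"
  leader_edges :: "'e set"
  follower_edges :: "'e set"
  ends :: "'e \<Rightarrow> 'v set"
  leader_cost :: "'e \<Rightarrow> real"
  follower_cost :: "'e \<Rightarrow> real"

definition edges :: "('v, 'e) bmst \<Rightarrow> 'e set" where
  "edges I = leader_edges I \<union> follower_edges I"

definition adjacent :: "('v, 'e) bmst \<Rightarrow> 'e set \<Rightarrow> ('v \<times> 'v) set" where
  "adjacent I F = {(u, v). \<exists>e\<in>F. ends I e = {u, v}}"

definition connects :: "('v, 'e) bmst \<Rightarrow> 'e set \<Rightarrow> bool" where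
  "connects I F \<longleftrightarrow> (\<forall>u\<in>verts I. \<forall>v\<in>verts I. (u, v) \<in> (adjacent I F)\<^sup>*)"

text \<open>Two parallel edges form a cycle of length 2, hence the separate distinctness of the edges.\<close>

definition is_cycle :: "('v, 'e) bmst \<Rightarrow> 'v list \<Rightarrow> 'e list \<Rightarrow> bool" where
  "is_cycle I vs es \<longleftrightarrow>
     es \<noteq> [] \<and> length vs = length es \<and> distinct vs \<and> distinct es \<and>
     (\<forall>i<length es. ends I (es ! i) = {vs ! i, vs ! (Suc i mod length es)})"

definition cycle_free :: "('v, 'e) bmst \<Rightarrow> 'e set \<Rightarrow> bool" where
  "cycle_free I F \<longleftrightarrow> \<not> (\<exists>vs es. set es \<subseteq> F \<and> is_cycle I vs es)"

definition spanning_tree :: "('v, 'e) bmst \<Rightarrow> 'e set \<Rightarrow> bool" where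
  "spanning_tree I T \<longleftrightarrow> T \<subseteq> edges I \<and> connects I T \<and> cycle_free I T"

definition bmst_instance :: "('v, 'e) bmst \<Rightarrow> bool" where
  "bmst_instance I \<longleftrightarrow>
     finite (verts I) \<and> verts I \<noteq> {} \<and>
     finite (edges I) \<and> leader_edges I \<inter> follower_edges I = {} \<and>
     (\<forall>e\<in>edges I. ends I e \<subseteq> verts I \<and> card (ends I e) = 2) \<and>
     (\<forall>e\<in>edges I. 0 \<le> leader_cost I e \<and> 0 \<le> follower_cost I e) \<and>
     connects I (edges I)"

definition feasible :: "('v, 'e) bmst \<Rightarrow> 'e set \<Rightarrow> bool" where
  "feasible I X \<longleftrightarrow>
     X \<subseteq> leader_edges I \<and> cycle_free I X \<and> connects I (X \<union> follower_edges I)"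

definition response :: "('v, 'e) bmst \<Rightarrow> 'e set \<Rightarrow> 'e set \<Rightarrow> bool" where
  "response I X Y \<longleftrightarrow> Y \<subseteq> follower_edges I \<and> spanning_tree I (X \<union> Y)"

text \<open>
  The maximum over the empty set is taken to be 0. For the follower this is immaterial: all
  responses to the same leader's choice have the same cardinality.
\<close>

definition bottleneck :: "('e \<Rightarrow> real) \<Rightarrow> 'e set \<Rightarrow> real" where
  "bottleneck w F = (if F = {} then 0 else Max (w ` F))"

datatype follower_version = Follower_Edges | Tree_Edges

fun follower_objective ::
  "follower_version \<Rightarrow> ('v, 'e) bmst \<Rightarrow> 'e set \<Rightarrow> 'e set \<Rightarrow> real" where
  "follower_objective Follower_Edges I X Y = bottleneck (follower_cost I) Y"
| "follower_objective Tree_Edges I X Y = bottleneck (follower_cost I) (X \<union> Y)"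

definition leader_objective :: "('v, 'e) bmst \<Rightarrow> 'e set \<Rightarrow> 'e set \<Rightarrow> real" where
  "leader_objective I X Y = bottleneck (leader_cost I) (X \<union> Y)"

definition optimal_response ::
  "follower_version \<Rightarrow> ('v, 'e) bmst \<Rightarrow> 'e set \<Rightarrow> 'e set \<Rightarrow> bool" where
  "optimal_response ver I X = is_arg_min (follower_objective ver I X) (response I X)"

definition pessimistic_value ::
  "follower_version \<Rightarrow> ('v, 'e) bmst \<Rightarrow> 'e set \<Rightarrow> real" where
  "pessimistic_value ver I X = Max (leader_objective I X ` {Y. optimal_response ver I X Y})"

definition pessimistic_optimum ::
  "follower_version \<Rightarrow> ('v, 'e) bmst \<Rightarrow> 'e set \<Rightarrow> bool" where
  "pessimistic_optimum ver I = is_arg_min (pessimistic_value ver I) (feasible I)"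


section \<open>Polynomial time on a random access machine\<close>

text \<open>
  Structured programs over natural-number variables, arrays of natural numbers, and arrays of
  real numbers, with unit cost per executed command or test. Two restrictions keep unit cost
  realistic. The only arithmetic on naturals is addition and truncated subtraction, so within
  \<open>t\<close> steps numbers have only \<open>O(t)\<close> more bits than the input. Real numbers can only be compared
  and copied, so for rational data the real operations are polynomial in the bit length of the
  input. Expressions are part of the fixed program, so their evaluation costs a constant number
  of elementary operations.
\<close>

datatype nexp =
    Num nat
  | Var string
  | Arr string nexp
  | Plus nexp nexp
  | Minus nexp nexp

datatype rexp = RArr string nexp

datatype bexp =
    Less nexp nexp
  | RLess rexp rexp
  | Neg bexp
  | Conj bexp bexp

datatype com =
    Skip
  | Assign string nexp
  | Store string nexp nexp
  | RStore string nexp rexp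
  | Seq com com
  | Cond bexp com com
  | While bexp com

record state =
  var :: "string \<Rightarrow> nat"
  arr :: "string \<Rightarrow> nat \<Rightarrow> nat"
  rarr :: "string \<Rightarrow> nat \<Rightarrow> real"

fun nval :: "nexp \<Rightarrow> state \<Rightarrow> nat" where
  "nval (Num k) s = k"
| "nval (Var x) s = var s x"
| "nval (Arr a i) s = arr s a (nval i s)"
| "nval (Plus e f) s = nval e s + nval f s"
| "nval (Minus e f) s = nval e s - nval f s"

fun rval :: "rexp \<Rightarrow> state \<Rightarrow> real" where
  "rval (RArr a i) s = rarr s a (nval i s)"

fun bval :: "bexp \<Rightarrow> state \<Rightarrow> bool" where
  "bval (Less e f) s \<longleftrightarrow> nval e s < nval f s"
| "bval (RLess e f) s \<longleftrightarrow> rval e s < rval f s"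
| "bval (Neg b) s \<longleftrightarrow> \<not> bval b s"
| "bval (Conj b b') s \<longleftrightarrow> bval b s \<and> bval b' s"

text \<open>\<open>runs p s t s'\<close>: program \<open>p\<close> started in \<open>s\<close> halts in \<open>s'\<close> after exactly \<open>t\<close> steps.\<close>

inductive runs :: "com \<Rightarrow> state \<Rightarrow> nat \<Rightarrow> state \<Rightarrow> bool" where
  Skip: "runs Skip s 1 s"
| Assign: "runs (Assign x e) s 1 (s\<lparr>var := (var s)(x := nval e s)\<rparr>)"
| Store: "runs (Store a i e) s 1
            (s\<lparr>arr := (arr s)(a := (arr s a)(nval i s := nval e s))\<rparr>)"
| RStore: "runs (RStore a i e) s 1
            (s\<lparr>rarr := (rarr s)(a := (rarr s a)(nval i s := rval e s))\<rparr>)"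
| Seq: "runs p s t s' \<Longrightarrow> runs q s' t' s'' \<Longrightarrow> runs (Seq p q) s (t + t') s''"
| CondTrue: "bval b s \<Longrightarrow> runs p s t s' \<Longrightarrow> runs (Cond b p q) s (Suc t) s'"
| CondFalse: "\<not> bval b s \<Longrightarrow> runs q s t s' \<Longrightarrow> runs (Cond b p q) s (Suc t) s'"
| WhileFalse: "\<not> bval b s \<Longrightarrow> runs (While b p) s 1 s"
| WhileTrue: "bval b s \<Longrightarrow> runs p s t s' \<Longrightarrow> runs (While b p) s' t' s'' \<Longrightarrow>
    runs (While b p) s (Suc (t + t')) s''"

inductive_cases SkipE: "runs Skip s t s'"
inductive_cases AssignE: "runs (Assign x e) s t s'"
inductive_cases StoreE: "runs (Store a i e) s t s'"
inductive_cases RStoreE: "runs (RStore a i e) s t s'"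
inductive_cases SeqE: "runs (Seq p q) s t s'"
inductive_cases CondE: "runs (Cond b p q) s t s'"
inductive_cases WhileE: "runs (While b p) s t s'"

lemma runs_deterministic:
  "runs p s t s' \<Longrightarrow> runs p s u s'' \<Longrightarrow> u = t \<and> s'' = s'"
proof (induction arbitrary: u s'' rule: runs.induct)
  case Skip
  then show ?case by (auto elim: SkipE)
next
  case Assign
  then show ?case by (auto elim: AssignE)
next
  case Store
  then show ?case by (auto elim: StoreE)
next
  case RStore
  then show ?case by (auto elim: RStoreE)
next
  case (Seq p s t s' q t' s'')
  from Seq.prems show ?case by (rule SeqE) (use Seq.IH in blast)
next
  case CondTrue
  from CondTrue.prems show ?case by (rule CondE) (use CondTrue.hyps CondTrue.IH in blast)+
next
  case CondFalse
  from CondFalse.prems show ?case by (rule CondE) (use CondFalse.hyps CondFalse.IH in blast)+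
next
  case WhileFalse
  from WhileFalse.prems show ?case by (rule WhileE) (use WhileFalse.hyps in simp)+
next
  case (WhileTrue b s p t s' t' s'')
  from WhileTrue.prems show ?case
    by (rule WhileE) (use WhileTrue.hyps WhileTrue.IH in blast)+
qed

text \<open>
  \<open>encodes i s\<close> says that \<open>s\<close> is an initial state presenting the instance \<open>i\<close>, and
  \<open>solves i s'\<close> that the final state \<open>s'\<close> holds a correct output for \<open>i\<close>. One program and one
  polynomial have to work for all instances.
\<close>

definition poly_time_solvable ::
  "'i set \<Rightarrow> ('i \<Rightarrow> nat) \<Rightarrow> ('i \<Rightarrow> state \<Rightarrow> bool) \<Rightarrow> ('i \<Rightarrow> state \<Rightarrow> bool) \<Rightarrow> bool" where
  "poly_time_solvable instances isize encodes solves \<longleftrightarrow>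
     (\<exists>(p :: com) (q :: nat poly). \<forall>i\<in>instances. \<forall>s. encodes i s \<longrightarrow>
        (\<exists>t s'. runs p s t s' \<and> t \<le> poly q (isize i) \<and> solves i s'))"


section \<open>Input and output of BMST\<close>

definition bmst_size :: "('v, 'e) bmst \<Rightarrow> nat" where
  "bmst_size I = card (verts I) + card (edges I)"

text \<open>
  Vertices and edges are numbered from 0. The two endpoints of an edge may be listed in either
  order. All memory not holding the input is 0.
\<close>

definition bmst_encodes :: "(nat, nat) bmst \<Rightarrow> state \<Rightarrow> bool" where
  "bmst_encodes I s \<longleftrightarrow> (\<exists>n m src dst.
     verts I = {..<n} \<and> edges I = {..<m} \<and>
     (\<forall>e<m. ends I e = {src e, dst e}) \<and>
     s = \<lparr>var = (\<lambda>_. 0)(''n'' := n, ''m'' := m),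
          arr = (\<lambda>_ _. 0)(
            ''src'' := (\<lambda>e. if e < m then src e else 0),
            ''dst'' := (\<lambda>e. if e < m then dst e else 0),
            ''leader'' := (\<lambda>e. if e < m \<and> e \<in> leader_edges I then 1 else 0)),
          rarr = (\<lambda>_ _. 0)(
            ''c'' := (\<lambda>e. if e < m then leader_cost I e else 0),
            ''d'' := (\<lambda>e. if e < m then follower_cost I e else 0))\<rparr>)"

text \<open>
  The output is the characteristic vector of an optimal leader's choice, together with the
  optimal value.
\<close>

definition bmst_solves :: "follower_version \<Rightarrow> (nat, nat) bmst \<Rightarrow> state \<Rightarrow> bool" where
  "bmst_solves ver I s \<longleftrightarrow> (\<exists>X. pessimistic_optimum ver I X \<and>
     (\<forall>e\<in>edges I. arr s ''X'' e = (if e \<in> X then 1 else 0)) \<and>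
     rarr s ''value'' 0 = pessimistic_value ver I X)"

end

theory Submission
  imports Defs
begin

text \<open>
  Once the leader has chosen \<open>X\<close> and the follower's optimal value is \<open>B\<close>, every follower's edge
  \<open>e\<close> with \<open>d(e) \<le> B\<close> whose endpoints \<open>X\<close> does not connect lies in some optimal response. So the
  pessimistic value of \<open>X\<close> is at most \<open>L\<close> iff \<open>c \<le> L\<close> on \<open>X\<close> and, for some threshold \<open>b \<ge> B\<close>,
  \<open>X\<close> connects the endpoints of all follower's edges with \<open>d \<le> b\<close> and \<open>c > L\<close>. For fixed \<open>L\<close> and
  \<open>b\<close> it only helps to enlarge the span of \<open>X\<close>, so one spanning forest of the leader's edges with
  \<open>c \<le> L\<close> (and \<open>d \<le> b\<close>, if the follower's objective includes \<open>X\<close>) is as good as any other choice.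
  Both thresholds range over the edge costs and 0, so trying all pairs, with Kruskal's algorithm for
  each, takes polynomial time.
\<close>

section \<open>Forests and reachability\<close>

lemma adjacent_mono: "F \<subseteq> G \<Longrightarrow> adjacent I F \<subseteq> adjacent I G"
  by (auto simp: adjacent_def)

lemma adjacent_Un: "adjacent I (F \<union> G) = adjacent I F \<union> adjacent I G"
  by (auto simp: adjacent_def)

lemma adjacent_insert:
  "ends I e = {p, q} \<Longrightarrow> adjacent I (insert e F) = insert (p, q) (insert (q, p) (adjacent I F))"
  by (auto simp: adjacent_def doubleton_eq_iff)

lemma adjacent_empty [simp]: "adjacent I {} = {}"
  by (simp add: adjacent_def)

lemma adjacentI: "e \<in> F \<Longrightarrow> ends I e = {u, v} \<Longrightarrow> (u, v) \<in> adjacent I F"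
  by (auto simp: adjacent_def)

lemma rtrancl_adjacent_sym: "(u, v) \<in> (adjacent I F)\<^sup>* \<Longrightarrow> (v, u) \<in> (adjacent I F)\<^sup>*"
  by (rule symD[OF sym_rtrancl]) (auto simp: sym_def adjacent_def insert_commute)

lemma cycle_free_empty [simp]: "cycle_free I {}"
  by (auto simp: cycle_free_def is_cycle_def)

lemma cycle_free_mono: "cycle_free I G \<Longrightarrow> F \<subseteq> G \<Longrightarrow> cycle_free I F"
  by (auto simp: cycle_free_def)

text \<open>The premise asks for less than inclusion: each edge of F only has to be bypassed by a
  path in G. This allows an edge set to be replaced by a spanning forest.\<close>

lemma connects_mono: "connects I F \<Longrightarrow> adjacent I F \<subseteq> (adjacent I G)\<^sup>* \<Longrightarrow> connects I G"
  unfolding connects_def by (meson rtrancl_subset_rtrancl subsetD)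

text \<open>A cycle through e, with e removed, is a path in F between the ends of e.\<close>

lemma cycle_free_insert:
  assumes F: "cycle_free I F" and e: "ends I e = {u, v}" and uv: "(u, v) \<notin> (adjacent I F)\<^sup>*"
  shows "cycle_free I (insert e F)"
  unfolding cycle_free_def
proof (intro notI, elim exE conjE)
  fix vs es assume sub: "set es \<subseteq> insert e F" and cyc: "is_cycle I vs es"
  let ?l = "length es"
  have "e \<in> set es"
    using F sub cyc by (auto simp: cycle_free_def)
  then obtain i where i: "i < ?l" "es ! i = e"
    by (auto simp: in_set_conv_nth)
  have dist: "distinct es" and step: "\<And>k. k < ?l \<Longrightarrow> ends I (es ! k) = {vs ! k, vs ! (Suc k mod ?l)}"
    using cyc by (auto simp: is_cycle_def)
  \<comment> \<open>The walk starts just behind the position i of e. For \<open>k < ?l\<close> it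
    has not yet come round to i again, and the edges are distinct, so it stays in F.\<close>
  have around: "(vs ! (Suc i mod ?l), vs ! ((Suc i + k) mod ?l)) \<in> (adjacent I F)\<^sup>*" if "k < ?l" for k
    using that
  proof (induction k)
    case (Suc k)
    let ?j = "(Suc i + k) mod ?l"
    have j: "?j < ?l" using i by (auto intro: mod_less_divisor)
    have "?j \<noteq> i"
      using i(1) Suc.prems by (cases "Suc i + k < ?l") (auto simp: le_mod_geq)
    then have "es ! ?j \<in> F"
      using sub dist i j by (metis insertE nth_eq_iff_index_eq nth_mem subsetD)
    then have "(vs ! ?j, vs ! (Suc ?j mod ?l)) \<in> adjacent I F"
      using step[OF j] by (rule adjacentI)
    moreover have "Suc ?j mod ?l = (Suc i + Suc k) mod ?l"
      by (simp add: mod_Suc_eq)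
    ultimately show ?case
      using Suc.IH Suc.prems by (metis Suc_lessD rtrancl.rtrancl_into_rtrancl)
  qed simp
  have "Suc i + (?l - 1) = i + ?l"
    using i by simp
  then have "(Suc i + (?l - 1)) mod ?l = i"
    using i by simp
  then have "(vs ! (Suc i mod ?l), vs ! i) \<in> (adjacent I F)\<^sup>*"
    using around[of "?l - 1"] i by fastforce
  moreover have "{u, v} = {vs ! i, vs ! (Suc i mod ?l)}"
    using step[OF i(1)] i(2) e by simp
  ultimately show False
    using uv rtrancl_adjacent_sym by (metis doubleton_eq_iff)
qed

text \<open>Induction along the path: if the new vertex has been visited before, the path is cut off
  at that visit; otherwise it is extended by the new edge.\<close>

lemma simple_path:
  assumes "(u, v) \<in> (adjacent I F)\<^sup>*"
  shows "\<exists>vs es. length vs = Suc (length es) \<and> vs ! 0 = u \<and> vs ! length es = v \<and> distinct vs \<and>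
    set es \<subseteq> F \<and> (\<forall>i<length es. ends I (es ! i) = {vs ! i, vs ! Suc i})"
  using assms
proof (induction rule: rtrancl_induct)
  case base
  show ?case by (rule exI[of _ "[u]"], rule exI[of _ "[]"]) simp
next
  case (step y z)
  then obtain vs es e where p: "length vs = Suc (length es)" "vs ! 0 = u" "vs ! length es = y"
      "distinct vs" "set es \<subseteq> F" "\<forall>i<length es. ends I (es ! i) = {vs ! i, vs ! Suc i}"
      and e: "e \<in> F" "ends I e = {y, z}"
    by (auto simp: adjacent_def)
  show ?case
  proof (cases "z \<in> set vs")
    case True
    then obtain j where "j < length vs" "vs ! j = z"
      by (auto simp: in_set_conv_nth)
    then show ?thesis
      using p by (intro exI[of _ "take (Suc j) vs"] exI[of _ "take j es"])
        (auto dest: in_set_takeD)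
  next
    case False
    then show ?thesis
      using p e by (intro exI[of _ "vs @ [z]"] exI[of _ "es @ [e]"])
        (auto simp: nth_append less_Suc_eq)
  qed
qed

text \<open>A simple path in F between the ends of e would be closed to a cycle by e. Since e is
  outside F, this also covers a path that consists of one edge parallel to e.\<close>

lemma not_connected_if_cycle_free_insert:
  assumes cf: "cycle_free I (insert e F)" and e: "e \<notin> F" "ends I e = {u, v}" "u \<noteq> v"
  shows "(u, v) \<notin> (adjacent I F)\<^sup>*"
proof
  assume "(u, v) \<in> (adjacent I F)\<^sup>*"
  then obtain vs es where p: "length vs = Suc (length es)" "vs ! 0 = u" "vs ! length es = v"
      "distinct vs" "set es \<subseteq> F" "\<And>i. i < length es \<Longrightarrow> ends I (es ! i) = {vs ! i, vs ! Suc i}"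
    using simple_path[of u v I F] by blast
  \<comment> \<open>An edge used at two positions would have the same end pair twice, which distinct
    vertices on an open path exclude.\<close>
  have "distinct es"
  proof (rule ccontr)
    assume "\<not> distinct es"
    then obtain i j where ij: "i < length es" "j < length es" "i \<noteq> j" "es ! i = es ! j"
      by (auto simp: distinct_conv_nth)
    then have "{vs ! i, vs ! Suc i} = {vs ! j, vs ! Suc j}"
      using p(6) by metis
    then show False
      using ij p(1,4) by (auto simp: doubleton_eq_iff nth_eq_iff_index_eq)
  qed
  \<comment> \<open>At the last position the index wraps around to 0: there e leads from v back to
    u.\<close>
  moreover have "ends I ((es @ [e]) ! i) = {vs ! i, vs ! (Suc i mod Suc (length es))}" if "i \<le> length es" for i
    using that p(2,3) p(6)[of i] e(2) by (cases "i = length es") (auto simp: nth_append)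
  ultimately have "is_cycle I vs (es @ [e])"
    using p e(1) unfolding is_cycle_def by auto
  moreover have "set (es @ [e]) \<subseteq> insert e F"
    using p(5) by auto
  ultimately show False
    using cf unfolding cycle_free_def by blast
qed

section \<open>Spanning forests of arbitrary edge sets\<close>

definition spanning_forest :: "('v, 'e) bmst \<Rightarrow> 'e set \<Rightarrow> 'e set \<Rightarrow> bool" where
  "spanning_forest I H F \<longleftrightarrow> F \<subseteq> H \<and> cycle_free I F \<and> adjacent I H \<subseteq> (adjacent I F)\<^sup>*"

text \<open>Take a maximal cycle-free set between F and H. An edge of H whose ends it does not join
  could still be added.\<close>

lemma spanning_forest_extending:
  assumes H: "finite H" and F: "F \<subseteq> H" "cycle_free I F"
  obtains T where "F \<subseteq> T" "spanning_forest I H T"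
proof -
  have "finite {T. T \<subseteq> H \<and> cycle_free I T}" "F \<in> {T. T \<subseteq> H \<and> cycle_free I T}"
    using H F by auto
  then obtain T where "T \<in> {T. T \<subseteq> H \<and> cycle_free I T}" "F \<subseteq> T"
      and "\<forall>S\<in>{T. T \<subseteq> H \<and> cycle_free I T}. T \<subseteq> S \<longrightarrow> T = S"
    by (meson finite_has_maximal2)
  then have T: "T \<subseteq> H" "cycle_free I T" "F \<subseteq> T"
      and max: "\<And>S. S \<subseteq> H \<Longrightarrow> cycle_free I S \<Longrightarrow> T \<subseteq> S \<Longrightarrow> T = S"
    by simp_all
  have "adjacent I H \<subseteq> (adjacent I T)\<^sup>*"
  proof (clarsimp simp: adjacent_def[of I H])
    fix u v e assume e: "e \<in> H" "ends I e = {u, v}"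
    show "(u, v) \<in> (adjacent I T)\<^sup>*"
    proof (rule ccontr)
      assume "(u, v) \<notin> (adjacent I T)\<^sup>*"
      then have "cycle_free I (insert e T)" "e \<notin> T"
        using cycle_free_insert[OF T(2) e(2)] adjacentI[OF _ e(2)] by blast+
      then show False
        using max[of "insert e T"] T e by blast
    qed
  qed
  then show ?thesis
    using that T unfolding spanning_forest_def by blast
qed

text \<open>One round of Kruskal's algorithm, stated as preservation of its invariant.\<close>

lemma spanning_forest_insert:
  assumes F: "spanning_forest I H F" and e: "ends I e = {p, q}"
  shows "spanning_forest I (insert e H) (if (p, q) \<in> (adjacent I F)\<^sup>* then F else insert e F)"
proof (cases "(p, q) \<in> (adjacent I F)\<^sup>*")
  case True
  then show ?thesis
    using F rtrancl_adjacent_sym[of p q] unfolding spanning_forest_def adjacent_insert[OF e] by auto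
next
  case False
  have "(adjacent I F)\<^sup>* \<subseteq> (adjacent I (insert e F))\<^sup>*"
    by (intro rtrancl_mono adjacent_mono) auto
  moreover have "(p, q) \<in> (adjacent I (insert e F))\<^sup>*" "(q, p) \<in> (adjacent I (insert e F))\<^sup>*"
    by (auto simp: adjacent_insert[OF e])
  ultimately show ?thesis
    using F False cycle_free_insert[OF _ e False]
    unfolding spanning_forest_def adjacent_insert[OF e, of H] by auto
qed

section \<open>Connected components as vertex labels\<close>

definition represents :: "('v, 'e) bmst \<Rightarrow> ('v \<Rightarrow> 'b) \<Rightarrow> 'e set \<Rightarrow> bool" where
  "represents I lab F \<longleftrightarrow>
     (\<forall>u\<in>verts I. \<forall>v\<in>verts I. lab u = lab v \<longleftrightarrow> (u, v) \<in> (adjacent I F)\<^sup>*)"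

lemma represents_spanning_forest:
  assumes "spanning_forest I H F"
  shows "represents I lab H \<longleftrightarrow> represents I lab F"
proof -
  have "(adjacent I H)\<^sup>* = (adjacent I F)\<^sup>*"
    using assms rtrancl_subset[of "adjacent I F" "adjacent I H"] adjacent_mono[of F H I]
    unfolding spanning_forest_def by blast
  then show ?thesis
    by (simp add: represents_def)
qed

text \<open>Giving the component of p the label of q merges the two components, and changes nothing
  if they coincide. Labels are controlled on vertices only, as array entries beyond the vertex
  numbers are arbitrary.\<close>

lemma represents_insert:
  assumes inst: "bmst_instance I" and F: "F \<subseteq> edges I" and lab: "represents I lab F"
    and e: "e \<in> edges I" "ends I e = {p, q}"
    and lab': "\<And>v. v \<in> verts I \<Longrightarrow> lab' v = (if lab v = lab p then lab q else lab v)"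
  shows "represents I lab' (insert e F)"
  unfolding represents_def
proof (intro ballI iffI)
  let ?R = "(adjacent I (insert e F))\<^sup>*"
  have pq: "p \<in> verts I" "q \<in> verts I"
    using inst e unfolding bmst_instance_def by auto
  have edge: "(p, q) \<in> ?R" "(q, p) \<in> ?R"
    by (auto simp: adjacent_insert[OF e(2)])
  have same: "(u, v) \<in> ?R" if "u \<in> verts I" "v \<in> verts I" "lab u = lab v" for u v
    using lab that rtrancl_mono[OF adjacent_mono[of F "insert e F" I]] unfolding represents_def by blast
  fix u v assume uv: "u \<in> verts I" "v \<in> verts I"
  {
    assume eq: "lab' u = lab' v"
    \<comment> \<open>The new label of x is the old label of some vertex reachable from x: of q if x
      lies in the component of p, and of x itself otherwise.\<close>
    have rep: "\<exists>w\<in>verts I. (x, w) \<in> ?R \<and> lab w = lab' x" if "x \<in> verts I" for x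
      using that lab'[OF that] pq edge same[of x p] by (cases "lab x = lab p") (auto intro: rtrancl_trans)
    obtain w w' where w: "w \<in> verts I" "(u, w) \<in> ?R" "lab w = lab' u"
        and w': "w' \<in> verts I" "(v, w') \<in> ?R" "lab w' = lab' v"
      using rep uv by meson
    have "(w, w') \<in> ?R"
      using same w w' eq by simp
    then show "(u, v) \<in> ?R"
      using w(2) rtrancl_adjacent_sym[OF w'(2)] by (meson rtrancl_trans)
  next
    assume "(u, v) \<in> ?R"
    \<comment> \<open>Membership in \<open>verts I\<close> is carried through the induction because
      the labels mean something only there.\<close>
    then have "v \<in> verts I \<and> lab' u = lab' v"
    proof (induction rule: rtrancl_induct)
      case (step y z)
      have "lab' p = lab' q"
        using lab' pq by simp
      moreover have "z \<in> verts I \<and> lab y = lab z" if yz: "(y, z) \<in> adjacent I F"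
      proof -
        have "z \<in> verts I"
          using yz F inst unfolding adjacent_def bmst_instance_def by force
        then show ?thesis
          using lab step.IH yz unfolding represents_def by blast
      qed
      ultimately show ?case
        using step pq lab' unfolding adjacent_insert[OF e(2)] by auto
    qed (use uv in simp)
    then show "lab' u = lab' v" ..
  }
qed

text \<open>Comparison with a single root suffices by symmetry and transitivity, so the program can
  test connectedness in one pass over the vertices.\<close>

lemma represents_connects:
  assumes "represents I lab F" "r \<in> verts I"
  shows "connects I F \<longleftrightarrow> (\<forall>v\<in>verts I. lab v = lab r)"
proof -
  have "connects I F \<longleftrightarrow> (\<forall>v\<in>verts I. (v, r) \<in> (adjacent I F)\<^sup>*)"
    using assms(2) rtrancl_adjacent_sym unfolding connects_def by (meson rtrancl_trans)
  then show ?thesis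
    using assms unfolding represents_def by simp
qed

section \<open>The leader's thresholds\<close>

text \<open>The bound on b accounts for the empty set, whose bottleneck is 0.\<close>

lemma bottleneck_le_iff:
  "finite F \<Longrightarrow> 0 \<le> b \<Longrightarrow> bottleneck w F \<le> b \<longleftrightarrow> (\<forall>e\<in>F. w e \<le> b)"
  by (auto simp: bottleneck_def)

lemma bottleneck_in: "finite F \<Longrightarrow> bottleneck w F \<in> insert 0 (w ` F)"
  using Max_in[of "w ` F"] by (auto simp: bottleneck_def)

lemma bottleneck_ge: "finite F \<Longrightarrow> e \<in> F \<Longrightarrow> w e \<le> bottleneck w F"
  by (auto simp: bottleneck_def)

lemma follower_objective_le_iff:
  assumes "finite X" "finite Y" "0 \<le> b"
  shows "follower_objective ver I X Y \<le> b \<longleftrightarrow>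
    (\<forall>e\<in>Y. follower_cost I e \<le> b) \<and> (ver = Tree_Edges \<longrightarrow> (\<forall>e\<in>X. follower_cost I e \<le> b))"
  using assms by (cases ver) (auto simp: bottleneck_le_iff)

lemma follower_objective_in:
  assumes "finite X" "finite Y"
  shows "follower_objective ver I X Y \<in> insert 0 (follower_cost I ` (X \<union> Y))"
  using assms bottleneck_in[of Y "follower_cost I"] bottleneck_in[of "X \<union> Y" "follower_cost I"]
  by (cases ver) auto

text \<open>L and b are guessed bounds for the leader's and the follower's value. The follower's
  costs of the leader's edges matter only where his objective ranges over the whole tree.\<close>

definition affordable :: "follower_version \<Rightarrow> ('v, 'e) bmst \<Rightarrow> real \<Rightarrow> real \<Rightarrow> 'e set" where
  "affordable ver I L b = {e \<in> leader_edges I. leader_cost I e \<le> L \<and>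
     (ver = Tree_Edges \<longrightarrow> follower_cost I e \<le> b)}"

text \<open>For cycle-free X this says that the follower can complete X with edges of cost at most
  b, and that no such completion contains an edge costing the leader more than L. Both conjuncts
  depend on X only through its components.\<close>

definition accepted :: "('v, 'e) bmst \<Rightarrow> 'e set \<Rightarrow> real \<Rightarrow> real \<Rightarrow> bool" where
  "accepted I X L b \<longleftrightarrow> connects I (X \<union> {e \<in> follower_edges I. follower_cost I e \<le> b}) \<and>
     (\<forall>e\<in>follower_edges I. \<forall>u v. follower_cost I e \<le> b \<longrightarrow> L < leader_cost I e \<longrightarrow> ends I e = {u, v} \<longrightarrow>
       (u, v) \<in> (adjacent I X)\<^sup>*)"

section \<open>Responses, their values and the correctness of the threshold test\<close>

context
  fixes I :: "('v, 'e) bmst"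
  assumes inst: "bmst_instance I"
begin

lemma finite_edge_subset:
  "F \<subseteq> edges I \<Longrightarrow> finite F" "F \<subseteq> leader_edges I \<Longrightarrow> finite F" "F \<subseteq> follower_edges I \<Longrightarrow> finite F"
  using inst unfolding bmst_instance_def edges_def by (auto intro: finite_subset)

text \<open>A spanning forest of \<open>X \<union> H\<close> that extends
  \<open>X \<union> F\<close> is a spanning tree, and its part outside X is the response. With empty
  F this yields a cheap response; with a singleton F it forces a chosen edge into one.\<close>

lemma response_extending:
  assumes X: "X \<subseteq> leader_edges I" and F: "F \<subseteq> H" "H \<subseteq> follower_edges I"
    and cf: "cycle_free I (X \<union> F)" and conn: "connects I (X \<union> H)"
  obtains Y where "F \<subseteq> Y" "Y \<subseteq> H" "response I X Y"
proof -
  have "finite (X \<union> H)"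
    using X F finite_edge_subset by simp
  then obtain T where T: "X \<union> F \<subseteq> T" "spanning_forest I (X \<union> H) T"
    using spanning_forest_extending[of "X \<union> H" "X \<union> F" I] F cf by blast
  have "X \<inter> H = {}"
    using X F inst unfolding bmst_instance_def by blast
  then have XY: "X \<union> (T - X) = T" "T - X \<subseteq> H" "F \<subseteq> T - X"
    using T F by (auto simp: spanning_forest_def)
  moreover have "spanning_tree I T"
    using T X F connects_mono[OF conn] unfolding spanning_tree_def spanning_forest_def edges_def
    by blast
  ultimately show ?thesis
    using that[of "T - X"] F unfolding response_def by auto
qed

lemma finite_responses: "finite {Y. response I X Y}"
  by (rule finite_subset[of _ "Pow (follower_edges I)"]) (auto simp: response_def finite_edge_subset)

lemma optimal_response_finite: "optimal_response ver I X Y \<Longrightarrow> Y \<subseteq> follower_edges I \<and> finite Y"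
  by (auto simp: optimal_response_def is_arg_min_def response_def finite_edge_subset)

lemma finite_optimal_responses: "finite {Y. optimal_response ver I X Y}"
  by (rule finite_subset[OF _ finite_responses[of X]]) (auto simp: optimal_response_def is_arg_min_def)

lemma optimal_response_exists:
  assumes "feasible I X"
  obtains Y where "optimal_response ver I X Y"
proof -
  obtain Y where "response I X Y"
    using assms response_extending[of X "{}" "follower_edges I"] by (auto simp: feasible_def) blast
  then show ?thesis
    using ex_is_arg_min_if_finite[OF finite_responses[of X], of "follower_objective ver I X"] that
    unfolding optimal_response_def by auto
qed

lemma pessimistic_value_ge:
  "optimal_response ver I X Y \<Longrightarrow> leader_objective I X Y \<le> pessimistic_value ver I X"
  unfolding pessimistic_value_def by (rule Max_ge) (auto simp: finite_optimal_responses)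

lemma pessimistic_value_attained:
  assumes "feasible I X"
  obtains Y where "optimal_response ver I X Y" "pessimistic_value ver I X = leader_objective I X Y"
proof -
  have "pessimistic_value ver I X \<in> leader_objective I X ` {Y. optimal_response ver I X Y}"
    unfolding pessimistic_value_def using optimal_response_exists[OF assms]
    by (intro Max_in) (auto simp: finite_optimal_responses)
  then show ?thesis using that by blast
qed

text \<open>There are finitely many feasible choices, and a spanning forest of all leader's edges is
  one of them.\<close>

lemma pessimistic_optimum_exists:
  obtains X where "pessimistic_optimum ver I X"
proof -
  obtain X where X: "spanning_forest I (leader_edges I) X"
    using spanning_forest_extending[of "leader_edges I" "{}" I] finite_edge_subset by auto
  have "adjacent I (edges I) \<subseteq> (adjacent I (X \<union> follower_edges I))\<^sup>*"
    using X rtrancl_mono[OF adjacent_mono[of X "X \<union> follower_edges I" I]]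
    unfolding spanning_forest_def edges_def adjacent_Un by blast
  then have "feasible I X"
    using X inst connects_mono unfolding feasible_def spanning_forest_def bmst_instance_def by blast
  moreover have "finite {X. feasible I X}"
    by (rule finite_subset[of _ "Pow (leader_edges I)"]) (auto simp: feasible_def finite_edge_subset)
  ultimately show ?thesis
    using ex_is_arg_min_if_finite[of "{X. feasible I X}" "pessimistic_value ver I"] that
    unfolding pessimistic_optimum_def by auto
qed

text \<open>Some response costs the follower at most b, so optimal ones do too. Their edges with c >
  L would have ends joined by X, and so close a cycle.\<close>

lemma accepted_sound:
  assumes X: "X \<subseteq> affordable ver I L b" "cycle_free I X" and acc: "accepted I X L b"
    and L: "0 \<le> L" and b: "0 \<le> b"
  shows "feasible I X" "pessimistic_value ver I X \<le> L"
proof -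
  have XL: "X \<subseteq> leader_edges I" and cX: "\<And>e. e \<in> X \<Longrightarrow> leader_cost I e \<le> L"
      and dX: "\<And>e. ver = Tree_Edges \<Longrightarrow> e \<in> X \<Longrightarrow> follower_cost I e \<le> b"
    using X by (auto simp: affordable_def)
  define H where "H = {e \<in> follower_edges I. follower_cost I e \<le> b}"
  have H: "H \<subseteq> follower_edges I" "connects I (X \<union> H)"
    using acc by (auto simp: H_def accepted_def)
  show feas: "feasible I X"
    unfolding feasible_def using XL X(2) connects_mono[OF H(2), of "X \<union> follower_edges I"] H(1)
      adjacent_mono[of "X \<union> H" "X \<union> follower_edges I" I] by blast
  \<comment> \<open>Z need not be optimal; it only bounds the follower's optimal value by b.\<close>
  obtain Z where Z: "Z \<subseteq> H" "response I X Z"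
    using response_extending[OF XL _ H(1) _ H(2), of "{}"] X(2) by auto
  have Zb: "follower_objective ver I X Z \<le> b"
    using Z(1) dX b finite_edge_subset(2)[OF XL] finite_edge_subset(3)[OF subset_trans[OF Z(1) H(1)]]
    by (subst follower_objective_le_iff) (auto simp: H_def)
  obtain Y where Y: "optimal_response ver I X Y"
      and val: "pessimistic_value ver I X = leader_objective I X Y"
    using pessimistic_value_attained[OF feas] by blast
  have "follower_objective ver I X Y \<le> b"
    using Y Z Zb unfolding optimal_response_def is_arg_min_linorder by fastforce
  then have Yb: "\<And>e. e \<in> Y \<Longrightarrow> follower_cost I e \<le> b"
    using Y b XL optimal_response_finite[OF Y] by (simp add: follower_objective_le_iff finite_edge_subset)
  have Ycf: "cycle_free I (X \<union> Y)" and YF: "Y \<subseteq> follower_edges I"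
    using Y by (auto simp: optimal_response_def is_arg_min_def response_def spanning_tree_def)
  have "leader_cost I e \<le> L" if e: "e \<in> Y" for e
  proof (rule ccontr)
    assume *: "\<not> leader_cost I e \<le> L"
    have eX: "e \<notin> X" and "card (ends I e) = 2"
      using e YF XL inst unfolding bmst_instance_def edges_def by blast+
    then obtain u v where uv: "ends I e = {u, v}" "u \<noteq> v"
      by (auto simp: card_2_iff)
    have "cycle_free I (insert e X)"
      using Ycf by (rule cycle_free_mono) (use e in auto)
    then have "(u, v) \<notin> (adjacent I X)\<^sup>*"
      using eX uv by (intro not_connected_if_cycle_free_insert)
    moreover have "(u, v) \<in> (adjacent I X)\<^sup>*"
      using acc * e Yb[OF e] YF uv(1) unfolding accepted_def by auto
    ultimately show False ..
  qed
  then show "pessimistic_value ver I X \<le> L"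
    using cX L finite_edge_subset(2)[OF XL] finite_edge_subset(3)[OF YF] unfolding val leader_objective_def
    by (subst bottleneck_le_iff) auto
qed

text \<open>Take L as the pessimistic value of X and b as the follower's optimal value. X consists
  of affordable edges, so every spanning forest of the affordable edges joins whatever X
  joins.\<close>

lemma optimum_accepted:
  assumes feas: "feasible I X"
  obtains b where "b \<in> insert 0 (follower_cost I ` edges I)"
    "pessimistic_value ver I X \<in> insert 0 (leader_cost I ` edges I)"
    "\<And>X'. spanning_forest I (affordable ver I (pessimistic_value ver I X) b) X' \<Longrightarrow>
       accepted I X' (pessimistic_value ver I X) b"
proof -
  define L where "L = pessimistic_value ver I X"
  obtain Y where Y: "optimal_response ver I X Y" and val: "L = leader_objective I X Y"
    using pessimistic_value_attained[OF feas] unfolding L_def by blast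
  define b where "b = follower_objective ver I X Y"
  define H where "H = {e \<in> follower_edges I. follower_cost I e \<le> b}"
  have X: "X \<subseteq> leader_edges I" "cycle_free I X"
    using feas by (auto simp: feasible_def)
  have resp: "Y \<subseteq> follower_edges I" "X \<union> Y \<subseteq> edges I" "connects I (X \<union> Y)"
    using Y by (auto simp: optimal_response_def is_arg_min_def response_def spanning_tree_def)
  have fin: "finite X" "finite Y"
    using X resp by (auto simp: finite_edge_subset)
  \<comment> \<open>Both thresholds are edge costs or, for an empty maximum, 0. This leaves finitely
    many pairs to try.\<close>
  have bin: "b \<in> insert 0 (follower_cost I ` edges I)"
    using follower_objective_in[OF fin, of ver I] resp(2) unfolding b_def by blast
  then have b0: "0 \<le> b"
    using inst by (auto simp: bmst_instance_def)
  have Lin: "L \<in> insert 0 (leader_cost I ` edges I)"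
    using bottleneck_in[of "X \<union> Y" "leader_cost I"] fin resp(2)
    unfolding val leader_objective_def by blast
  have "\<forall>e\<in>X. leader_cost I e \<le> L"
    using bottleneck_ge[of "X \<union> Y"] fin by (auto simp: val leader_objective_def)
  moreover have obj: "(\<forall>e\<in>Y. follower_cost I e \<le> b) \<and> (ver = Tree_Edges \<longrightarrow> (\<forall>e\<in>X. follower_cost I e \<le> b))"
    using follower_objective_le_iff[OF fin b0, of ver I] unfolding b_def by simp
  ultimately have XA: "X \<subseteq> affordable ver I L b" and YH: "Y \<subseteq> H"
    using X resp by (auto simp: affordable_def H_def)
  \<comment> \<open>Otherwise some response Z of cost at most b contains e. Z is then optimal as
    well and pushes the pessimistic value above L.\<close>
  have joined: "(u, v) \<in> (adjacent I X)\<^sup>*"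
    if e: "e \<in> H" "L < leader_cost I e" "ends I e = {u, v}" for e u v
  proof (rule ccontr)
    assume "(u, v) \<notin> (adjacent I X)\<^sup>*"
    then have "cycle_free I (X \<union> {e})"
      using cycle_free_insert[OF X(2) e(3)] by simp
    moreover have "connects I (X \<union> H)"
      using connects_mono[OF resp(3), of "X \<union> H"] adjacent_mono[of "X \<union> Y" "X \<union> H" I] YH by blast
    ultimately obtain Z where Z: "{e} \<subseteq> Z" "Z \<subseteq> H" "response I X Z"
      using response_extending[OF X(1), of "{e}" H] e by (auto simp: H_def)
    have finZ: "finite Z"
      using Z by (auto simp: response_def finite_edge_subset)
    have "follower_objective ver I X Z \<le> b"
      using obj Z(2) by (subst follower_objective_le_iff) (auto simp: fin finZ b0 H_def)
    then have "optimal_response ver I X Z"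
      using Y Z(3) unfolding b_def optimal_response_def is_arg_min_linorder by force
    then have "leader_objective I X Z \<le> L"
      unfolding L_def by (rule pessimistic_value_ge)
    moreover have "leader_cost I e \<le> leader_objective I X Z"
      unfolding leader_objective_def using Z(1) fin finZ by (intro bottleneck_ge) auto
    ultimately show False
      using e(2) by simp
  qed
  have "accepted I X' L b" if X': "spanning_forest I (affordable ver I L b) X'" for X'
  proof -
    \<comment> \<open>Connectedness and \<open>joined\<close> are transferred from X to X' through
      this inclusion.\<close>
    have adj: "adjacent I X \<subseteq> (adjacent I X')\<^sup>*"
      using X' adjacent_mono[OF XA, of I] unfolding spanning_forest_def by blast
    then have "(adjacent I X)\<^sup>* \<subseteq> (adjacent I X')\<^sup>*"
      by (rule rtrancl_subset_rtrancl)
    moreover have "adjacent I (X \<union> Y) \<subseteq> (adjacent I (X' \<union> H))\<^sup>*"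
      using adj rtrancl_mono[OF adjacent_mono[of X' "X' \<union> H" I]] adjacent_mono[OF YH, of I]
      unfolding adjacent_Un by blast
    ultimately show ?thesis
      using connects_mono[OF resp(3)] joined unfolding accepted_def H_def by blast
  qed
  then show ?thesis
    using that bin Lin unfolding L_def by blast
qed

end

section \<open>Timed reasoning about programs\<close>

fun vars_written :: "com \<Rightarrow> string set" where
  "vars_written (Assign x e) = {x}"
| "vars_written (Seq p q) = vars_written p \<union> vars_written q"
| "vars_written (Cond b p q) = vars_written p \<union> vars_written q"
| "vars_written (While b p) = vars_written p"
| "vars_written _ = {}"

fun arrs_written :: "com \<Rightarrow> string set" where
  "arrs_written (Store a i e) = {a}"
| "arrs_written (Seq p q) = arrs_written p \<union> arrs_written q"
| "arrs_written (Cond b p q) = arrs_written p \<union> arrs_written q"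
| "arrs_written (While b p) = arrs_written p"
| "arrs_written _ = {}"

fun rarrs_written :: "com \<Rightarrow> string set" where
  "rarrs_written (RStore a i e) = {a}"
| "rarrs_written (Seq p q) = rarrs_written p \<union> rarrs_written q"
| "rarrs_written (Cond b p q) = rarrs_written p \<union> rarrs_written q"
| "rarrs_written (While b p) = rarrs_written p"
| "rarrs_written _ = {}"

text \<open>A syntactic frame condition: with it, loop invariants need to mention only what the
  program assigns.\<close>

definition frame :: "com \<Rightarrow> state \<Rightarrow> state \<Rightarrow> bool" where
  "frame p s s' \<longleftrightarrow> (\<forall>x. x \<notin> vars_written p \<longrightarrow> var s' x = var s x) \<and>
     (\<forall>a. a \<notin> arrs_written p \<longrightarrow> arr s' a = arr s a) \<and>
     (\<forall>a. a \<notin> rarrs_written p \<longrightarrow> rarr s' a = rarr s a)"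

lemma frame_var: "frame p s s' \<Longrightarrow> x \<notin> vars_written p \<Longrightarrow> var s' x = var s x"
  and frame_arr: "frame p s s' \<Longrightarrow> a \<notin> arrs_written p \<Longrightarrow> arr s' a = arr s a"
  and frame_rarr: "frame p s s' \<Longrightarrow> a \<notin> rarrs_written p \<Longrightarrow> rarr s' a = rarr s a"
  by (auto simp: frame_def)

lemma runs_frame: "runs p s t s' \<Longrightarrow> frame p s s'"
  by (induction rule: runs.induct) (auto simp: frame_def)

text \<open>Total correctness with an upper time bound in place of the exact count of
  \<open>runs\<close>, so that branches of different length can share a bound.\<close>

definition reaches :: "com \<Rightarrow> state \<Rightarrow> nat \<Rightarrow> (state \<Rightarrow> bool) \<Rightarrow> bool" where
  "reaches p s T Q \<longleftrightarrow> (\<exists>t s'. runs p s t s' \<and> t \<le> T \<and> Q s')"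

lemma reaches_mono:
  assumes "reaches p s T Q" "T \<le> U" "\<And>s'. frame p s s' \<Longrightarrow> Q s' \<Longrightarrow> R s'"
  shows "reaches p s U R"
  using assms runs_frame unfolding reaches_def by (meson le_trans)

lemma reaches_Skip: "Q s \<Longrightarrow> reaches Skip s 1 Q"
  using runs.Skip unfolding reaches_def by blast

lemma reaches_Assign: "Q (s\<lparr>var := (var s)(x := nval e s)\<rparr>) \<Longrightarrow> reaches (Assign x e) s 1 Q"
  using runs.Assign unfolding reaches_def by blast

lemma reaches_Store:
  "Q (s\<lparr>arr := (arr s)(a := (arr s a)(nval i s := nval e s))\<rparr>) \<Longrightarrow> reaches (Store a i e) s 1 Q"
  using runs.Store unfolding reaches_def by blast

lemma reaches_RStore:
  "Q (s\<lparr>rarr := (rarr s)(a := (rarr s a)(nval i s := rval e s))\<rparr>) \<Longrightarrow> reaches (RStore a i e) s 1 Q"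
  using runs.RStore unfolding reaches_def by blast

lemma reaches_Seq:
  assumes "reaches p s T (\<lambda>s'. reaches q s' U Q)"
  shows "reaches (Seq p q) s (T + U) Q"
  using assms runs.Seq unfolding reaches_def by (meson add_le_mono)

lemma reaches_Seq_frame:
  assumes "reaches p s T Q" "\<And>s'. frame p s s' \<Longrightarrow> Q s' \<Longrightarrow> reaches q s' U R"
  shows "reaches (Seq p q) s (T + U) R"
  by (rule reaches_Seq[OF reaches_mono[OF assms(1) order_refl assms(2)]])

lemma reaches_Cond:
  assumes "bval b s \<Longrightarrow> reaches p s T Q" "\<not> bval b s \<Longrightarrow> reaches q s T Q"
  shows "reaches (Cond b p q) s (Suc T) Q"
  using assms runs.CondTrue runs.CondFalse unfolding reaches_def by (cases "bval b s") (meson Suc_le_mono)+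

section \<open>Counting loops\<close>

definition for_loop :: "string \<Rightarrow> nexp \<Rightarrow> com \<Rightarrow> com" where
  "for_loop x bound p = Seq (Assign x (Num 0))
     (While (Less (Var x) bound) (Seq p (Assign x (Plus (Var x) (Num 1)))))"

lemma written_for_loop [simp]:
  "vars_written (for_loop x bound p) = insert x (vars_written p)"
  "arrs_written (for_loop x bound p) = arrs_written p"
  "rarrs_written (for_loop x bound p) = rarrs_written p"
  by (auto simp: for_loop_def)

text \<open>Each round costs the body plus one test and one increment; the final 2 is the
  initialisation and the failing test. The bound expression is evaluated anew in each round, hence
  the demand that it stay equal to N. \<open>J (Suc k)\<close> is required of the state after the
  increment.\<close>

lemma reaches_for_loop:
  assumes init: "J 0 (s\<lparr>var := (var s)(x := 0)\<rparr>)"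
    and bound: "\<And>s'. frame (for_loop x bound p) s s' \<Longrightarrow> nval bound s' = N"
    and step: "\<And>k s'. k < N \<Longrightarrow> frame (for_loop x bound p) s s' \<Longrightarrow> var s' x = k \<Longrightarrow> J k s' \<Longrightarrow>
      reaches p s' T (\<lambda>s''. var s'' x = k \<and> J (Suc k) (s''\<lparr>var := (var s'')(x := Suc k)\<rparr>))"
  shows "reaches (for_loop x bound p) s (N * (T + 2) + 2) (J N)"
proof -
  let ?w = "While (Less (Var x) bound) (Seq p (Assign x (Plus (Var x) (Num 1))))"
  have loop: "reaches ?w s' ((N - k) * (T + 2) + 1) (J N)"
    if "k \<le> N" "frame (for_loop x bound p) s s'" "var s' x = k" "J k s'" for k s'
    using that
  \<comment> \<open>Downward induction from N, where the loop stops, because the remaining rounds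
    determine the remaining time.\<close>
  proof (induction k arbitrary: s' rule: inc_induct)
    case base
    then have "\<not> bval (Less (Var x) bound) s'"
      using bound by simp
    from runs.WhileFalse[OF this] base.prems(3) show ?case
      unfolding reaches_def by (intro exI conjI) auto
  next
    case (step k)
    obtain t s2 where s2: "runs p s' t s2" "t \<le> T" "var s2 x = k"
        "J (Suc k) (s2\<lparr>var := (var s2)(x := Suc k)\<rparr>)"
      using assms(3)[OF step.hyps(2) step.prems] unfolding reaches_def by blast
    let ?s3 = "s2\<lparr>var := (var s2)(x := Suc k)\<rparr>"
    have run: "runs (Seq p (Assign x (Plus (Var x) (Num 1)))) s' (t + 1) ?s3"
      using runs.Seq[OF s2(1) runs.Assign[of x "Plus (Var x) (Num 1)"]] s2(3) by simp
    have "frame (for_loop x bound p) s ?s3"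
      using runs_frame[OF s2(1)] step.prems(1) by (auto simp: frame_def)
    then obtain t' s4 where s4: "runs ?w ?s3 t' s4" "t' \<le> (N - Suc k) * (T + 2) + 1" "J N s4"
      using step.IH[of ?s3] s2(4) unfolding reaches_def by auto
    have "N - k = Suc (N - Suc k)"
      using step.hyps(2) by simp
    then have "Suc (t + 1 + t') \<le> (N - k) * (T + 2) + 1"
      using s2(2) s4(2) by simp
    moreover have "bval (Less (Var x) bound) s'"
      using bound[OF step.prems(1)] step.prems(2) step.hyps(2) by simp
    ultimately show ?case
      using runs.WhileTrue[OF _ run s4(1)] s4(3) unfolding reaches_def by (intro exI conjI)
  qed
  let ?s0 = "s\<lparr>var := (var s)(x := 0)\<rparr>"
  have "frame (for_loop x bound p) s ?s0"
    by (auto simp: frame_def)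
  then have "reaches ?w ?s0 (N * (T + 2) + 1) (J N)"
    using loop[of 0 ?s0] init by simp
  then have "reaches (for_loop x bound p) s (1 + (N * (T + 2) + 1)) (J N)"
    unfolding for_loop_def by (intro reaches_Seq reaches_Assign) simp
  then show ?thesis
    by simp
qed

section \<open>Kruskal's algorithm with component labels\<close>

definition Eq :: "nexp \<Rightarrow> nexp \<Rightarrow> bexp" where
  "Eq e f = Conj (Neg (Less e f)) (Neg (Less f e))"

lemma bval_Eq [simp]: "bval (Eq e f) s \<longleftrightarrow> nval e s = nval f s"
  by (auto simp: Eq_def)

definition fill :: "string \<Rightarrow> string \<Rightarrow> nexp \<Rightarrow> nexp \<Rightarrow> com" where
  "fill a x bound f = for_loop x bound (Store a (Var x) f)"

text \<open>The flag is only ever cleared, so consecutive checks accumulate a conjunction.\<close>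

definition check :: "string \<Rightarrow> nexp \<Rightarrow> bexp \<Rightarrow> com" where
  "check x bound bad = for_loop x bound (Cond bad (Assign ''ok'' (Num 0)) Skip)"

definition src_label :: nexp where "src_label = Arr ''lab'' (Arr ''src'' (Var ''e''))"
definition dst_label :: nexp where "dst_label = Arr ''lab'' (Arr ''dst'' (Var ''e''))"

text \<open>Both labels are saved first, because the loop overwrites the very entries that
  \<open>src_label\<close> reads.\<close>

definition merge :: com where
  "merge = Seq (Assign ''a'' src_label) (Seq (Assign ''b'' dst_label)
     (for_loop ''v'' (Var ''n'') (Cond (Eq (Arr ''lab'' (Var ''v'')) (Var ''a''))
        (Store ''lab'' (Var ''v'') (Var ''b'')) Skip)))"

text \<open>No sorting is involved: \<open>test\<close> applies the thresholds and any spanning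
  forest will do. The labels are not initialised, so a run can continue from an earlier
  forest.\<close>

definition kruskal :: "string \<Rightarrow> bexp \<Rightarrow> com" where
  "kruskal y test = for_loop ''e'' (Var ''m'') (Seq (Store y (Var ''e'') (Num 0))
     (Cond (Conj test (Neg (Eq src_label dst_label)))
        (Seq (Store y (Var ''e'') (Num 1)) merge) Skip))"

lemma written [simp]:
  "vars_written (fill a x bound f) = {x}" "arrs_written (fill a x bound f) = {a}"
  "rarrs_written (fill a x bound f) = {}"
  "vars_written (check x bound bad) = {x, ''ok''}" "arrs_written (check x bound bad) = {}"
  "rarrs_written (check x bound bad) = {}"
  "vars_written merge = {''a'', ''b'', ''v''}" "arrs_written merge = {''lab''}" "rarrs_written merge = {}"
  "vars_written (kruskal y test) = {''e'', ''a'', ''b'', ''v''}" "arrs_written (kruskal y test) = {y, ''lab''}"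
  "rarrs_written (kruskal y test) = {}"
  by (auto simp: fill_def check_def merge_def kruskal_def)

lemma reaches_fill:
  assumes "\<And>s'. frame (fill a x bound f) s s' \<Longrightarrow> nval bound s' = N"
    and "\<And>s'. frame (fill a x bound f) s s' \<Longrightarrow> var s' x < N \<Longrightarrow> nval f s' = g (var s' x)"
  shows "reaches (fill a x bound f) s (N * 3 + 2) (\<lambda>s'. \<forall>k<N. arr s' a k = g k)"
proof -
  have "reaches (fill a x bound f) s (N * (1 + 2) + 2) (\<lambda>s'. \<forall>k<N. arr s' a k = g k)"
    unfolding fill_def
    by (rule reaches_for_loop; (rule reaches_Store)?)
      (use assms in \<open>auto simp: fill_def less_Suc_eq\<close>)
  then show ?thesis by (rule reaches_mono) auto
qed

lemma reaches_check:
  assumes "\<And>s'. frame (check x bound bad) s s' \<Longrightarrow> nval bound s' = N"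
    and "\<And>s'. frame (check x bound bad) s s' \<Longrightarrow> var s' x < N \<Longrightarrow> bval bad s' \<longleftrightarrow> B (var s' x)"
    and "x \<noteq> ''ok''"
  shows "reaches (check x bound bad) s (N * 4 + 2)
    (\<lambda>s'. var s' ''ok'' = (if \<exists>k<N. B k then 0 else var s ''ok''))"
proof -
  have "reaches (check x bound bad) s (N * (Suc 1 + 2) + 2)
    (\<lambda>s'. var s' ''ok'' = (if \<exists>k<N. B k then 0 else var s ''ok''))"
    unfolding check_def
    by (rule reaches_for_loop; (rule reaches_Cond, rule reaches_Assign, rule_tac[2] reaches_Skip)?)
      (use assms in \<open>auto simp: check_def less_Suc_eq\<close>)
  then show ?thesis by (rule reaches_mono) auto
qed

lemma reaches_merge:
  "reaches merge s (var s ''n'' * 4 + 4) (\<lambda>s'. \<forall>v<var s ''n''. arr s' ''lab'' v =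
     (if arr s ''lab'' v = nval src_label s then nval dst_label s else arr s ''lab'' v))"
proof -
  define a b where "a = nval src_label s" and "b = nval dst_label s"
  let ?body = "Cond (Eq (Arr ''lab'' (Var ''v'')) (Var ''a'')) (Store ''lab'' (Var ''v'') (Var ''b'')) Skip"
  \<comment> \<open>Entries from k on are still the original ones, so the test in round k compares
    the old label of k.\<close>
  let ?J = "\<lambda>k s'. \<forall>v. arr s' ''lab'' v = (if v < k \<and> arr s ''lab'' v = a then b else arr s ''lab'' v)"
  have "reaches (for_loop ''v'' (Var ''n'') ?body) s1 (var s ''n'' * (Suc 1 + 2) + 2) (?J (var s ''n''))"
    if s1: "var s1 ''n'' = var s ''n''" "var s1 ''a'' = a" "var s1 ''b'' = b" "arr s1 = arr s" for s1
  proof (rule reaches_for_loop)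
    fix k s' assume fr: "frame (for_loop ''v'' (Var ''n'') ?body) s1 s'"
      and k: "var s' ''v'' = k" and J: "?J k s'"
    have ab: "var s' ''a'' = a" "var s' ''b'' = b"
      using frame_var[OF fr, of "''a''"] frame_var[OF fr, of "''b''"] s1 by auto
    show "reaches ?body s' (Suc 1) (\<lambda>s''. var s'' ''v'' = k \<and> ?J (Suc k) (s''\<lparr>var := (var s'')(''v'' := Suc k)\<rparr>))"
      by (rule reaches_Cond, rule reaches_Store, rule_tac[2] reaches_Skip)
        (use ab k J in \<open>auto simp: less_Suc_eq\<close>)
  next
    fix s' assume "frame (for_loop ''v'' (Var ''n'') ?body) s1 s'"
    from frame_var[OF this, of "''n''"] show "nval (Var ''n'') s' = var s ''n''"
      using s1 by simp
  qed (use s1 in simp)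
  then have "reaches merge s (1 + (1 + (var s ''n'' * (Suc 1 + 2) + 2))) (?J (var s ''n''))"
    unfolding merge_def
    by (intro reaches_Seq reaches_Assign) (simp add: a_def b_def dst_label_def)
  then show ?thesis
    by (rule reaches_mono) (auto simp: a_def b_def)
qed

text \<open>In contrast to \<open>bmst_encodes\<close>, this constrains only the input data and
  therefore survives changes of the working memory.\<close>

definition presents :: "(nat, nat) bmst \<Rightarrow> state \<Rightarrow> bool" where
  "presents I s \<longleftrightarrow> bmst_instance I \<and> verts I = {..<var s ''n''} \<and> edges I = {..<var s ''m''} \<and>
     (\<forall>e<var s ''m''. ends I e = {arr s ''src'' e, arr s ''dst'' e} \<and>
        (0 < arr s ''leader'' e \<longleftrightarrow> e \<in> leader_edges I) \<and>
        rarr s ''c'' e = leader_cost I e \<and> rarr s ''d'' e = follower_cost I e) \<and>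
     rarr s ''c'' (var s ''m'') = 0 \<and> rarr s ''d'' (var s ''m'') = 0"

lemma presents_frame:
  assumes "frame p s s'" "presents I s" "vars_written p \<inter> {''n'', ''m''} = {}"
    "arrs_written p \<inter> {''src'', ''dst'', ''leader''} = {}" "rarrs_written p \<inter> {''c'', ''d''} = {}"
  shows "presents I s'"
proof -
  have "var s' ''n'' = var s ''n''" "var s' ''m'' = var s ''m''" "arr s' ''src'' = arr s ''src''"
    "arr s' ''dst'' = arr s ''dst''" "arr s' ''leader'' = arr s ''leader''"
    "rarr s' ''c'' = rarr s ''c''" "rarr s' ''d'' = rarr s ''d''"
    using assms(3-5) frame_var[OF assms(1)] frame_arr[OF assms(1)] frame_rarr[OF assms(1)] by auto
  then show ?thesis
    using assms(2) by (simp add: presents_def)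
qed

text \<open>F is the forest already present in the labels. It is empty when the leader's forest is
  built, and is that forest when the follower's cheap edges are merged in.\<close>

lemma reaches_kruskal:
  assumes pres: "presents I s" and F0: "represents I (arr s ''lab'') F" "cycle_free I F" "F \<subseteq> edges I"
    and S: "S \<subseteq> edges I"
    and test: "\<And>s'. frame (kruskal y test) s s' \<Longrightarrow> var s' ''e'' < var s ''m'' \<Longrightarrow>
      bval test s' \<longleftrightarrow> var s' ''e'' \<in> S"
    and y: "y \<notin> {''lab'', ''src'', ''dst'', ''leader''}"
  shows "reaches (kruskal y test) s (var s ''m'' * (var s ''n'' * 4 + 9) + 2)
    (\<lambda>s'. represents I (arr s' ''lab'') (F \<union> S) \<and>
      (\<exists>Y. spanning_forest I (F \<union> S) (F \<union> Y) \<and> Y \<subseteq> S \<and>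
         (\<forall>e<var s ''m''. arr s' y e = (if e \<in> Y then 1 else 0))))"
proof -
  define n m where "n = var s ''n''" and "m = var s ''m''"
  have inst: "bmst_instance I"
    using pres by (simp add: presents_def)
  let ?inner = "Seq (Store y (Var ''e'') (Num 1)) merge"
  let ?body = "Seq (Store y (Var ''e'') (Num 0)) (Cond (Conj test (Neg (Eq src_label dst_label))) ?inner Skip)"
  let ?J = "\<lambda>k s'. \<exists>Y. represents I (arr s' ''lab'') (F \<union> Y) \<and>
    spanning_forest I (F \<union> (S \<inter> {..<k})) (F \<union> Y) \<and> Y \<subseteq> S \<inter> {..<k} \<and>
    (\<forall>e<k. arr s' y e = (if e \<in> Y then 1 else 0))"
  \<comment> \<open>Per edge: two stores, the test, the merge and two steps of loop control,
    together \<open>4 * n + 9\<close>.\<close>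
  have "reaches (kruskal y test) s (m * ((1 + Suc (1 + (n * 4 + 4))) + 2) + 2) (?J m)"
    unfolding kruskal_def
  proof (rule reaches_for_loop, fold kruskal_def)
    show "?J 0 (s\<lparr>var := (var s)(''e'' := 0)\<rparr>)"
      using F0 by (intro exI[of _ "{}"]) (auto simp: spanning_forest_def)
  next
    fix s' assume "frame (kruskal y test) s s'"
    from frame_var[OF this, of "''m''"] show "nval (Var ''m'') s' = m"
      by (simp add: m_def)
  next
    fix k s' assume k: "k < m" and fr: "frame (kruskal y test) s s'" and e: "var s' ''e'' = k" and J: "?J k s'"
    obtain Y where Y: "represents I (arr s' ''lab'') (F \<union> Y)" "spanning_forest I (F \<union> (S \<inter> {..<k})) (F \<union> Y)"
        "Y \<subseteq> S \<inter> {..<k}" "\<And>e. e < k \<Longrightarrow> arr s' y e = (if e \<in> Y then 1 else 0)"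
      using J by blast
    have pres': "presents I s'"
      using presents_frame[OF fr pres] y by auto
    define p q where "p = arr s' ''src'' k" and "q = arr s' ''dst'' k"
    have nm: "var s' ''n'' = n" "var s' ''m'' = m"
      using frame_var[OF fr, of "''n''"] frame_var[OF fr, of "''m''"] by (auto simp: n_def m_def)
    have ends: "ends I k = {p, q}" "k \<in> edges I" "verts I = {..<n}"
      using pres' k unfolding presents_def by (auto simp: nm p_def q_def)
    have pq: "p \<in> verts I" "q \<in> verts I"
      using ends inst unfolding bmst_instance_def by auto
    let ?s0 = "s'\<lparr>arr := (arr s')(y := (arr s' y)(k := 0))\<rparr>"
    have fr0: "frame (kruskal y test) s ?s0"
      using fr by (auto simp: frame_def)
    have lab0: "nval src_label ?s0 = arr s' ''lab'' p" "nval dst_label ?s0 = arr s' ''lab'' q"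
      using y e by (auto simp: src_label_def dst_label_def p_def q_def)
    have lab_iff: "arr s' ''lab'' p = arr s' ''lab'' q \<longleftrightarrow> (p, q) \<in> (adjacent I (F \<union> Y))\<^sup>*"
      using Y(1) pq by (auto simp: represents_def)
    have test0: "bval test ?s0 \<longleftrightarrow> k \<in> S"
      using test[OF fr0] e k by (simp add: m_def)
    \<comment> \<open>Folding replaces reachability by equality of labels, which is what the program
      branches on.\<close>
    note ins = spanning_forest_insert[OF Y(2) ends(1), folded lab_iff]
    show "reaches ?body s' (1 + Suc (1 + (n * 4 + 4)))
      (\<lambda>s''. var s'' ''e'' = k \<and> ?J (Suc k) (s''\<lparr>var := (var s'')(''e'' := Suc k)\<rparr>))"
    proof (rule reaches_Seq, rule reaches_Store, simp only: nval.simps e, rule reaches_Cond)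
      assume "bval (Conj test (Neg (Eq src_label dst_label))) ?s0"
      then have new: "k \<in> S" "arr s' ''lab'' p \<noteq> arr s' ''lab'' q"
        using test0 lab0 by auto
      let ?s1 = "?s0\<lparr>arr := (arr ?s0)(y := (arr ?s0 y)(k := 1))\<rparr>"
      have lab1: "nval src_label ?s1 = arr s' ''lab'' p" "nval dst_label ?s1 = arr s' ''lab'' q"
          "arr ?s1 ''lab'' = arr s' ''lab''"
        using y e by (auto simp: src_label_def dst_label_def p_def q_def)
      show "reaches ?inner ?s0 (1 + (n * 4 + 4))
        (\<lambda>s''. var s'' ''e'' = k \<and> ?J (Suc k) (s''\<lparr>var := (var s'')(''e'' := Suc k)\<rparr>))"
      proof (rule reaches_Seq, rule reaches_Store, rule reaches_mono[OF reaches_merge])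
        let ?t = "?s0\<lparr>arr := (arr ?s0)(y := (arr ?s0 y)(nval (Var ''e'') ?s0 := nval (Num 1) ?s0))\<rparr>"
        have t: "?t = ?s1"
          using e by simp
        show "var ?t ''n'' * 4 + 4 \<le> n * 4 + 4"
          using nm by simp
        fix s2 assume fr2: "frame merge ?t s2" and lab2: "\<forall>v<var ?t ''n''. arr s2 ''lab'' v =
          (if arr ?t ''lab'' v = nval src_label ?t then nval dst_label ?t else arr ?t ''lab'' v)"
        have "\<forall>v<n. arr s2 ''lab'' v = (if arr s' ''lab'' v = arr s' ''lab'' p then arr s' ''lab'' q else arr s' ''lab'' v)"
          using lab2 unfolding t lab1 using nm(1) by simp
        then have rep: "represents I (arr s2 ''lab'') (insert k (F \<union> Y))"
          using Y(3) F0(3) S ends by (intro represents_insert[OF inst _ Y(1)]) auto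
        have yk: "arr s2 y = (arr s' y)(k := 1)"
          using frame_arr[OF fr2, of y] y e by simp
        have ek: "var s2 ''e'' = k"
          using frame_var[OF fr2, of "''e''"] e by simp
        have "S \<inter> {..<Suc k} = insert k (S \<inter> {..<k})"
          using new by auto
        then have "represents I (arr s2 ''lab'') (F \<union> insert k Y) \<and>
          spanning_forest I (F \<union> (S \<inter> {..<Suc k})) (F \<union> insert k Y) \<and> insert k Y \<subseteq> S \<inter> {..<Suc k} \<and>
          (\<forall>e<Suc k. arr s2 y e = (if e \<in> insert k Y then 1 else 0))"
          using rep ins new Y(3,4) yk by (auto simp: less_Suc_eq)
        then show "var s2 ''e'' = k \<and> ?J (Suc k) (s2\<lparr>var := (var s2)(''e'' := Suc k)\<rparr>)"
          using ek by (intro conjI exI[of _ "insert k Y"]) simp_all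
      qed
    next
      assume "\<not> bval (Conj test (Neg (Eq src_label dst_label))) ?s0"
      then have old: "k \<in> S \<Longrightarrow> arr s' ''lab'' p = arr s' ''lab'' q"
        using test0 lab0 by auto
      \<comment> \<open>Edge k is either outside S or has ends already joined, so the forest remains
        spanning without it.\<close>
      have "spanning_forest I (F \<union> (S \<inter> {..<Suc k})) (F \<union> Y)"
      proof (cases "k \<in> S")
        case True
        then have "S \<inter> {..<Suc k} = insert k (S \<inter> {..<k})"
          by auto
        then show ?thesis
          using ins old[OF True] by simp
      next
        case False
        then have "S \<inter> {..<Suc k} = S \<inter> {..<k}"
          by (auto simp: less_Suc_eq)
        then show ?thesis
          using Y(2) by simp
      qed
      then have "?J (Suc k) ?s0"
        using Y y by (intro exI[of _ Y]) (auto simp: less_Suc_eq)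
      then show "reaches Skip ?s0 (1 + (n * 4 + 4))
        (\<lambda>s''. var s'' ''e'' = k \<and> ?J (Suc k) (s''\<lparr>var := (var s'')(''e'' := Suc k)\<rparr>))"
        using e by (intro reaches_mono[OF reaches_Skip[of "\<lambda>s''. s'' = ?s0"]]) auto
    qed
  qed
  moreover have "S \<inter> {..<m} = S"
    using S pres by (auto simp: presents_def m_def)
  ultimately have fin: "reaches (kruskal y test) s (m * ((1 + Suc (1 + (n * 4 + 4))) + 2) + 2)
    (\<lambda>s'. \<exists>Y. represents I (arr s' ''lab'') (F \<union> Y) \<and>
      spanning_forest I (F \<union> S) (F \<union> Y) \<and> Y \<subseteq> S \<and> (\<forall>e<m. arr s' y e = (if e \<in> Y then 1 else 0)))"
    by simp
  show ?thesis
    by (rule reaches_mono[OF fin])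
      (auto simp: n_def m_def represents_spanning_forest)
qed

section \<open>Searching all pairs of thresholds\<close>

definition leader_edge :: bexp where
  "leader_edge = Less (Num 0) (Arr ''leader'' (Var ''e''))"

definition exceeds :: "string \<Rightarrow> string \<Rightarrow> bexp" where
  "exceeds a x = RLess (RArr a (Var x)) (RArr a (Var ''e''))"

text \<open>The second \<^const>\<open>leader_edge\<close> is only a conjunct without effect.\<close>

definition affordable_test :: "follower_version \<Rightarrow> bexp" where
  "affordable_test ver = Conj leader_edge (Conj (Neg (exceeds ''c'' ''i''))
     (if ver = Tree_Edges then Neg (exceeds ''d'' ''j'') else leader_edge))"

definition cheap_test :: bexp where
  "cheap_test = Conj (Neg leader_edge) (Neg (exceeds ''d'' ''j''))"

definition bad_test :: bexp where
  "bad_test = Conj cheap_test (Conj (exceeds ''c'' ''i'') (Neg (Eq src_label dst_label)))"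

text \<open>The order matters: \<open>bad_test\<close> needs the labels of the leader's forest
  alone, so it precedes the second Kruskal pass, which adds the follower's edges to the same labels.
  That pass writes to \<open>Z\<close> to preserve the forest in \<open>Y\<close>.\<close>

definition candidate :: "follower_version \<Rightarrow> com" where
  "candidate ver = Seq (Assign ''ok'' (Num 1)) (Seq (fill ''lab'' ''v'' (Var ''n'') (Var ''v''))
     (Seq (kruskal ''Y'' (affordable_test ver)) (Seq (check ''e'' (Var ''m'') bad_test)
     (Seq (kruskal ''Z'' cheap_test)
       (check ''v'' (Var ''n'') (Neg (Eq (Arr ''lab'' (Var ''v'')) (Arr ''lab'' (Num 0)))))))))"

text \<open>The negated conjunction encodes the implication that, if something was found before, the
  new threshold must be strictly smaller. The stored value is the threshold L, so far only an upper
  bound for the value of the stored choice.\<close>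

definition record_candidate :: com where
  "record_candidate = Cond (Conj (Less (Num 0) (Var ''ok''))
       (Neg (Conj (Less (Num 0) (Var ''found'')) (Neg (RLess (RArr ''c'' (Var ''i'')) (RArr ''value'' (Num 0)))))))
     (Seq (Assign ''found'' (Num 1)) (Seq (RStore ''value'' (Num 0) (RArr ''c'' (Var ''i'')))
       (fill ''X'' ''e'' (Var ''m'') (Arr ''Y'' (Var ''e'')))))
     Skip"

text \<open>
  The loops include the index \<open>m\<close>, where the cost arrays hold 0: the threshold of an empty maximum.
\<close>

definition solver :: "follower_version \<Rightarrow> com" where
  "solver ver = for_loop ''i'' (Plus (Var ''m'') (Num 1)) (for_loop ''j'' (Plus (Var ''m'') (Num 1))
     (Seq (candidate ver) record_candidate))"

lemma written_solver [simp]: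
  "vars_written (candidate ver) = {''ok'', ''v'', ''e'', ''a'', ''b''}"
  "arrs_written (candidate ver) = {''lab'', ''Y'', ''Z''}" "rarrs_written (candidate ver) = {}"
  "vars_written record_candidate = {''found'', ''e''}" "arrs_written record_candidate = {''X''}"
  "rarrs_written record_candidate = {''value''}"
  by (auto simp: candidate_def record_candidate_def)

section \<open>Meaning of the tests in states that present the instance\<close>

lemma bval_leader_edge:
  "presents I s \<Longrightarrow> var s ''e'' < var s ''m'' \<Longrightarrow> bval leader_edge s \<longleftrightarrow> var s ''e'' \<in> leader_edges I"
  by (simp add: leader_edge_def presents_def)

lemma leader_edge_iff:
  "presents I s \<Longrightarrow> e < var s ''m'' \<Longrightarrow> e \<in> leader_edges I \<longleftrightarrow> e \<notin> follower_edges I"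
  unfolding presents_def bmst_instance_def edges_def by (metis Un_iff disjoint_iff lessThan_iff)

lemma bval_affordable_test:
  "presents I s \<Longrightarrow> var s ''e'' < var s ''m'' \<Longrightarrow> bval (affordable_test ver) s \<longleftrightarrow>
     var s ''e'' \<in> affordable ver I (rarr s ''c'' (var s ''i'')) (rarr s ''d'' (var s ''j''))"
  by (auto simp: affordable_test_def affordable_def exceeds_def bval_leader_edge) (auto simp: presents_def)

lemma bval_cheap_test:
  "presents I s \<Longrightarrow> var s ''e'' < var s ''m'' \<Longrightarrow> bval cheap_test s \<longleftrightarrow>
     var s ''e'' \<in> {e \<in> follower_edges I. follower_cost I e \<le> rarr s ''d'' (var s ''j'')}"
  by (auto simp: cheap_test_def exceeds_def bval_leader_edge leader_edge_iff) (auto simp: presents_def)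

lemma bval_bad_test:
  assumes pres: "presents I s" and e: "var s ''e'' < var s ''m''" and X: "represents I (arr s ''lab'') X"
  shows "bval bad_test s \<longleftrightarrow> var s ''e'' \<in> follower_edges I \<and>
    follower_cost I (var s ''e'') \<le> rarr s ''d'' (var s ''j'') \<and>
    rarr s ''c'' (var s ''i'') < leader_cost I (var s ''e'') \<and>
    (\<exists>u v. ends I (var s ''e'') = {u, v} \<and> (u, v) \<notin> (adjacent I X)\<^sup>*)"
proof -
  define p q where "p = arr s ''src'' (var s ''e'')" and "q = arr s ''dst'' (var s ''e'')"
  have ends: "ends I (var s ''e'') = {p, q}" "ends I (var s ''e'') \<subseteq> verts I"
    using pres e unfolding presents_def bmst_instance_def p_def q_def by auto
  have "arr s ''lab'' p = arr s ''lab'' q \<longleftrightarrow> (p, q) \<in> (adjacent I X)\<^sup>*"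
    using X ends unfolding represents_def by auto
  \<comment> \<open>The ends are stored in one order, whereas \<open>accepted\<close> ranges over
    both; reachability is symmetric.\<close>
  moreover have "(\<exists>u v. ends I (var s ''e'') = {u, v} \<and> (u, v) \<notin> (adjacent I X)\<^sup>*) \<longleftrightarrow> (p, q) \<notin> (adjacent I X)\<^sup>*"
    using rtrancl_adjacent_sym[of p q I X] rtrancl_adjacent_sym[of q p I X]
    unfolding ends(1) doubleton_eq_iff by blast
  moreover have "rarr s ''c'' (var s ''e'') = leader_cost I (var s ''e'')"
    using pres e by (simp add: presents_def)
  ultimately show ?thesis
    using bval_cheap_test[OF pres e]
    by (auto simp: bad_test_def exceeds_def src_label_def dst_label_def p_def q_def)
qed

text \<open>Which forest is found depends on the numbering of the edges, hence the existential
  quantifier.\<close>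

lemma reaches_candidate:
  assumes pres: "presents I s"
  defines "n \<equiv> var s ''n''" and "m \<equiv> var s ''m''"
    and "L \<equiv> rarr s ''c'' (var s ''i'')" and "b \<equiv> rarr s ''d'' (var s ''j'')"
  shows "reaches (candidate ver) s
    (1 + ((n * 3 + 2) + ((m * (n * 4 + 9) + 2) + ((m * 4 + 2) + ((m * (n * 4 + 9) + 2) + (n * 4 + 2))))))
    (\<lambda>s'. \<exists>X. spanning_forest I (affordable ver I L b) X \<and>
       (\<forall>e<m. arr s' ''Y'' e = (if e \<in> X then 1 else 0)) \<and> (0 < var s' ''ok'' \<longleftrightarrow> accepted I X L b))"
    (is "reaches _ _ _ ?Q")
proof -
  \<comment> \<open>What every phase preserves: the instance, its dimensions and the current pair of
    thresholds.\<close>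
  let ?C = "\<lambda>s'. presents I s' \<and> var s' ''n'' = n \<and> var s' ''m'' = m \<and>
    rarr s' ''c'' (var s' ''i'') = L \<and> rarr s' ''d'' (var s' ''j'') = b"
  have C_frame: "?C s2" if "frame p s1 s2" "?C s1" "vars_written p \<inter> {''n'', ''m'', ''i'', ''j''} = {}"
    "arrs_written p \<inter> {''src'', ''dst'', ''leader''} = {}" "rarrs_written p = {}" for p s1 s2
    using that presents_frame[OF that(1)] frame_var[OF that(1)] frame_rarr[OF that(1)] by auto
  let ?A = "affordable ver I L b"
  let ?H = "{e \<in> follower_edges I. follower_cost I e \<le> b}"
  have inst: "bmst_instance I" and V: "verts I = {..<n}" and E: "edges I = {..<m}"
    using pres by (auto simp: presents_def n_def m_def)
  have AE: "?A \<subseteq> edges I" and HE: "?H \<subseteq> edges I"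
    by (auto simp: affordable_def edges_def)
  have root: "0 \<in> verts I"
    using inst V by (cases n) (auto simp: bmst_instance_def)
  let ?s0 = "s\<lparr>var := (var s)(''ok'' := 1)\<rparr>"
  have C0: "?C ?s0"
    using pres by (simp add: presents_def n_def m_def L_def b_def)
  show ?thesis
    unfolding candidate_def
  proof (rule reaches_Seq, rule reaches_Assign, simp only: nval.simps, rule reaches_Seq_frame)
    show "reaches (fill ''lab'' ''v'' (Var ''n'') (Var ''v'')) ?s0 (n * 3 + 2) (\<lambda>s'. \<forall>k<n. arr s' ''lab'' k = k)"
    proof (rule reaches_fill)
      fix s' assume "frame (fill ''lab'' ''v'' (Var ''n'') (Var ''v'')) ?s0 s'"
      from C_frame[OF this C0] show "nval (Var ''n'') s' = n"
        by simp
    qed simp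
  next
    fix s1 assume fr1: "frame (fill ''lab'' ''v'' (Var ''n'') (Var ''v'')) ?s0 s1"
      and lab1: "\<forall>k<n. arr s1 ''lab'' k = k"
    have C1: "?C s1" and ok1: "var s1 ''ok'' = 1"
      using C_frame[OF fr1 C0] frame_var[OF fr1, of "''ok''"] by auto
    have rep1: "represents I (arr s1 ''lab'') {}"
      using lab1 by (auto simp: represents_def V)
    show "reaches (Seq (kruskal ''Y'' (affordable_test ver)) (Seq (check ''e'' (Var ''m'') bad_test)
     (Seq (kruskal ''Z'' cheap_test)
       (check ''v'' (Var ''n'') (Neg (Eq (Arr ''lab'' (Var ''v'')) (Arr ''lab'' (Num 0))))))))
      s1 ((m * (n * 4 + 9) + 2) + ((m * 4 + 2) + ((m * (n * 4 + 9) + 2) + (n * 4 + 2)))) ?Q"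
    proof (rule reaches_Seq_frame)
      show "reaches (kruskal ''Y'' (affordable_test ver)) s1 (m * (n * 4 + 9) + 2)
        (\<lambda>s'. \<exists>X. represents I (arr s' ''lab'') X \<and> spanning_forest I ?A X \<and>
           (\<forall>e<m. arr s' ''Y'' e = (if e \<in> X then 1 else 0)))"
      proof (rule reaches_mono[OF reaches_kruskal[where F = "{}" and S = ?A]])
        show "bval (affordable_test ver) s' \<longleftrightarrow> var s' ''e'' \<in> ?A"
          if "frame (kruskal ''Y'' (affordable_test ver)) s1 s'" "var s' ''e'' < var s1 ''m''" for s'
          using bval_affordable_test[of I s' ver] C_frame[OF that(1) C1] C1 that(2) by simp
      qed (use C1 rep1 AE in \<open>auto simp: represents_spanning_forest\<close>)
    next
      fix s2 assume fr2: "frame (kruskal ''Y'' (affordable_test ver)) s1 s2"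
        and "\<exists>X. represents I (arr s2 ''lab'') X \<and> spanning_forest I ?A X \<and>
           (\<forall>e<m. arr s2 ''Y'' e = (if e \<in> X then 1 else 0))"
      then obtain X where rep2: "represents I (arr s2 ''lab'') X" and X: "spanning_forest I ?A X"
          and Y2: "\<forall>e<m. arr s2 ''Y'' e = (if e \<in> X then 1 else 0)"
        by blast
      have C2: "?C s2" and ok2: "var s2 ''ok'' = 1"
        using C_frame[OF fr2 C1] frame_var[OF fr2, of "''ok''"] ok1 by auto
      \<comment> \<open>B collects the violations of the second conjunct of
        \<open>accepted\<close>.\<close>
      define B where "B e \<longleftrightarrow> e \<in> follower_edges I \<and> follower_cost I e \<le> b \<and> L < leader_cost I e \<and>
        (\<exists>u v. ends I e = {u, v} \<and> (u, v) \<notin> (adjacent I X)\<^sup>*)" for e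
      have acc: "accepted I X L b \<longleftrightarrow> connects I (X \<union> ?H) \<and> \<not> (\<exists>e<m. B e)"
        using E unfolding accepted_def B_def edges_def by blast
      show "reaches (Seq (check ''e'' (Var ''m'') bad_test) (Seq (kruskal ''Z'' cheap_test)
         (check ''v'' (Var ''n'') (Neg (Eq (Arr ''lab'' (Var ''v'')) (Arr ''lab'' (Num 0)))))))
        s2 ((m * 4 + 2) + ((m * (n * 4 + 9) + 2) + (n * 4 + 2))) ?Q"
      proof (rule reaches_Seq_frame, rule reaches_check[where N = m and B = B])
        fix s' assume fr: "frame (check ''e'' (Var ''m'') bad_test) s2 s'"
        show "nval (Var ''m'') s' = m"
          using C_frame[OF fr C2] by simp
        assume "var s' ''e'' < m"
        then show "bval bad_test s' \<longleftrightarrow> B (var s' ''e'')"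
          using bval_bad_test[of I s' X] C_frame[OF fr C2] frame_arr[OF fr, of "''lab''"] rep2
          by (simp add: B_def)
      next
        fix s3 assume fr3: "frame (check ''e'' (Var ''m'') bad_test) s2 s3"
          and "var s3 ''ok'' = (if \<exists>k<m. B k then 0 else var s2 ''ok'')"
        then have ok3: "var s3 ''ok'' = (if \<exists>k<m. B k then 0 else 1)"
          using ok2 by simp
        have C3: "?C s3" and Y3: "arr s3 = arr s2"
          using C_frame[OF fr3 C2] frame_arr[OF fr3] by auto
        show "reaches (Seq (kruskal ''Z'' cheap_test)
            (check ''v'' (Var ''n'') (Neg (Eq (Arr ''lab'' (Var ''v'')) (Arr ''lab'' (Num 0))))))
          s3 ((m * (n * 4 + 9) + 2) + (n * 4 + 2)) ?Q"
        proof (rule reaches_Seq_frame)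
          \<comment> \<open>The labels still belong to X, which is cycle-free, so the pass may start
            from X.\<close>
          show "reaches (kruskal ''Z'' cheap_test) s3 (m * (n * 4 + 9) + 2)
            (\<lambda>s'. represents I (arr s' ''lab'') (X \<union> ?H))"
          proof (rule reaches_mono[OF reaches_kruskal[where F = X and S = ?H]])
            show "bval cheap_test s' \<longleftrightarrow> var s' ''e'' \<in> ?H"
              if "frame (kruskal ''Z'' cheap_test) s3 s'" "var s' ''e'' < var s3 ''m''" for s'
              using bval_cheap_test[of I s'] C_frame[OF that(1) C3] C3 that(2) by simp
          qed (use C3 Y3 rep2 X AE HE in \<open>auto simp: spanning_forest_def\<close>)
        next
          fix s4 assume fr4: "frame (kruskal ''Z'' cheap_test) s3 s4"
            and rep4: "represents I (arr s4 ''lab'') (X \<union> ?H)"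
          have C4: "?C s4" and Y4: "arr s4 ''Y'' = arr s2 ''Y''" and ok4: "var s4 ''ok'' = var s3 ''ok''"
            using C_frame[OF fr4 C3] frame_arr[OF fr4, of "''Y''"] Y3 frame_var[OF fr4, of "''ok''"] by auto
          let ?last = "check ''v'' (Var ''n'') (Neg (Eq (Arr ''lab'' (Var ''v'')) (Arr ''lab'' (Num 0))))"
          define D where "D \<longleftrightarrow> (\<exists>v<n. arr s4 ''lab'' v \<noteq> arr s4 ''lab'' 0)"
          have conn: "connects I (X \<union> ?H) \<longleftrightarrow> \<not> D"
            unfolding represents_connects[OF rep4 root] V D_def by blast
          show "reaches ?last s4 (n * 4 + 2) ?Q"
          proof (rule reaches_mono[OF reaches_check[where N = n and B = "\<lambda>v. arr s4 ''lab'' v \<noteq> arr s4 ''lab'' 0"]])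
            fix s' assume fr: "frame ?last s4 s'"
            show "nval (Var ''n'') s' = n"
              using C_frame[OF fr C4] by simp
            show "bval (Neg (Eq (Arr ''lab'' (Var ''v'')) (Arr ''lab'' (Num 0)))) s' \<longleftrightarrow>
              arr s4 ''lab'' (var s' ''v'') \<noteq> arr s4 ''lab'' 0"
              using frame_arr[OF fr, of "''lab''"] by simp
            assume "var s' ''ok'' = (if \<exists>v<n. arr s4 ''lab'' v \<noteq> arr s4 ''lab'' 0 then 0 else var s4 ''ok'')"
            then have "0 < var s' ''ok'' \<longleftrightarrow> accepted I X L b"
              unfolding D_def[symmetric] acc conn ok4 ok3 by simp
            then show "?Q s'"
              using X Y2 Y4 frame_arr[OF fr, of "''Y''"] by (intro exI[of _ X]) simp
          qed simp_all
        qed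
      qed simp
    qed
  qed
qed

text \<open>An inequality suffices during the search; equality with the stored value follows only
  once all pairs have been tried.\<close>

definition best :: "follower_version \<Rightarrow> (nat, nat) bmst \<Rightarrow> state \<Rightarrow> bool" where
  "best ver I s \<longleftrightarrow> (0 < var s ''found'' \<longrightarrow> (\<exists>X. feasible I X \<and>
     pessimistic_value ver I X \<le> rarr s ''value'' 0 \<and>
     (\<forall>e\<in>edges I. arr s ''X'' e = (if e \<in> X then 1 else 0))))"

text \<open>
  The premise speaks of all spanning forests, so that it does not depend on the one that the
  program happens to find.
\<close>

definition seen :: "follower_version \<Rightarrow> (nat, nat) bmst \<Rightarrow> state \<Rightarrow> real \<Rightarrow> real \<Rightarrow> bool" where
  "seen ver I s L b \<longleftrightarrow> ((\<forall>X. spanning_forest I (affordable ver I L b) X \<longrightarrow> accepted I X L b) \<longrightarrow>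
     0 < var s ''found'' \<and> rarr s ''value'' 0 \<le> L)"

lemma best_seen_update [simp]:
  "x \<noteq> ''found'' \<Longrightarrow> best ver I (s\<lparr>var := (var s)(x := k)\<rparr>) = best ver I s"
  "x \<noteq> ''found'' \<Longrightarrow> seen ver I (s\<lparr>var := (var s)(x := k)\<rparr>) L b = seen ver I s L b"
  by (auto simp: best_def seen_def)

lemma presents_nonneg:
  "presents I s \<Longrightarrow> k \<le> var s ''m'' \<Longrightarrow> 0 \<le> rarr s ''c'' k \<and> 0 \<le> rarr s ''d'' k"
  by (cases "k = var s ''m''") (auto simp: presents_def bmst_instance_def)

text \<open>The expanded sum of the bounds for \<open>candidate\<close> and
  \<open>record_candidate\<close>.\<close>

definition step_time :: "nat \<Rightarrow> nat \<Rightarrow> nat" where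
  "step_time n m = 8 * m * n + 7 * n + 25 * m + 16"

text \<open>Pairs stay seen because \<open>found\<close> is never reset and the stored value never
  increases.\<close>

lemma reaches_step:
  assumes pres: "presents I s" and ij: "var s ''i'' \<le> var s ''m''" "var s ''j'' \<le> var s ''m''"
    and best: "best ver I s"
  defines "L \<equiv> rarr s ''c'' (var s ''i'')" and "b \<equiv> rarr s ''d'' (var s ''j'')"
  shows "reaches (Seq (candidate ver) record_candidate) s (step_time (var s ''n'') (var s ''m''))
    (\<lambda>s'. best ver I s' \<and> seen ver I s' L b \<and> (\<forall>L' b'. seen ver I s L' b' \<longrightarrow> seen ver I s' L' b'))"
    (is "reaches _ _ _ ?Q")
proof -
  define n m where "n = var s ''n''" and "m = var s ''m''"
  have E: "edges I = {..<m}"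
    using pres by (simp add: presents_def m_def)
  have "reaches (Seq (candidate ver) record_candidate) s
    ((1 + ((n * 3 + 2) + ((m * (n * 4 + 9) + 2) + ((m * 4 + 2) + ((m * (n * 4 + 9) + 2) + (n * 4 + 2)))))) +
       Suc (1 + (1 + (m * 3 + 2)))) ?Q"
  proof (rule reaches_Seq_frame[OF reaches_candidate[OF pres, of ver, folded n_def m_def L_def b_def]])
    fix s1 assume fr: "frame (candidate ver) s s1"
      and "\<exists>X. spanning_forest I (affordable ver I L b) X \<and>
       (\<forall>e<m. arr s1 ''Y'' e = (if e \<in> X then 1 else 0)) \<and> (0 < var s1 ''ok'' \<longleftrightarrow> accepted I X L b)"
    then obtain X where X: "spanning_forest I (affordable ver I L b) X"
        and Y: "\<forall>e<m. arr s1 ''Y'' e = (if e \<in> X then 1 else 0)"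
        and ok: "0 < var s1 ''ok'' \<longleftrightarrow> accepted I X L b"
      by - (elim exE conjE, rule that)
    have same: "var s1 ''found'' = var s ''found''" "var s1 ''i'' = var s ''i''" "var s1 ''m'' = m"
      "arr s1 ''X'' = arr s ''X''" "rarr s1 = rarr s"
      using frame_var[OF fr] frame_arr[OF fr] frame_rarr[OF fr] by (auto simp: m_def)
    show "reaches record_candidate s1 (Suc (1 + (1 + (m * 3 + 2)))) ?Q"
      unfolding record_candidate_def
    proof (rule reaches_Cond)
      let ?b = "Conj (Less (Num 0) (Var ''ok''))
       (Neg (Conj (Less (Num 0) (Var ''found'')) (Neg (RLess (RArr ''c'' (Var ''i'')) (RArr ''value'' (Num 0))))))"
      assume "bval ?b s1"
      then have acc: "accepted I X L b" and less: "0 < var s ''found'' \<Longrightarrow> L < rarr s ''value'' 0"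
        using ok same by (auto simp: L_def)
      let ?s2 = "s1\<lparr>var := (var s1)(''found'' := 1), rarr := (rarr s1)(''value'' := (rarr s1 ''value'')(0 := L))\<rparr>"
      let ?fill = "fill ''X'' ''e'' (Var ''m'') (Arr ''Y'' (Var ''e''))"
      have fill: "reaches ?fill ?s2 (m * 3 + 2) (\<lambda>s'. \<forall>k<m. arr s' ''X'' k = (if k \<in> X then 1 else 0))"
      proof (rule reaches_fill)
        fix s' assume fr': "frame ?fill ?s2 s'"
        show "nval (Var ''m'') s' = m"
          using frame_var[OF fr', of "''m''"] same by simp
        assume "var s' ''e'' < m"
        then show "nval (Arr ''Y'' (Var ''e'')) s' = (if var s' ''e'' \<in> X then 1 else 0)"
          using frame_arr[OF fr', of "''Y''"] Y by simp
      qed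
      have "reaches ?fill ?s2 (m * 3 + 2) ?Q"
      proof (rule reaches_mono[OF fill order_refl])
        fix s' assume fr': "frame ?fill ?s2 s'" and X': "\<forall>k<m. arr s' ''X'' k = (if k \<in> X then 1 else 0)"
        have new: "var s' ''found'' = 1" "rarr s' ''value'' 0 = L"
          using frame_var[OF fr', of "''found''"] frame_rarr[OF fr', of "''value''"] by auto
        have "feasible I X" "pessimistic_value ver I X \<le> L"
          using accepted_sound[of I X ver L b] X acc pres presents_nonneg[OF pres] ij
          by (auto simp: presents_def spanning_forest_def L_def b_def)
        then have "best ver I s'"
          using X' E new unfolding best_def by (intro impI exI[of _ X]) auto
        then show "?Q s'"
          using new less by (auto simp: seen_def)
      qed
      then show "reaches (Seq (Assign ''found'' (Num 1)) (Seq (RStore ''value'' (Num 0) (RArr ''c'' (Var ''i''))) ?fill))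
        s1 (1 + (1 + (m * 3 + 2))) ?Q"
        using same by (intro reaches_Seq reaches_Assign reaches_RStore) (simp add: L_def)
    next
      let ?b = "Conj (Less (Num 0) (Var ''ok''))
       (Neg (Conj (Less (Num 0) (Var ''found'')) (Neg (RLess (RArr ''c'' (Var ''i'')) (RArr ''value'' (Num 0))))))"
      assume "\<not> bval ?b s1"
      \<comment> \<open>Nothing is recorded if the candidate is rejected, which refutes the premise
        of \<open>seen\<close>, or if the stored value is already at most L.\<close>
      then have "accepted I X L b \<longrightarrow> 0 < var s ''found'' \<and> rarr s ''value'' 0 \<le> L"
        using ok same by (auto simp: L_def)
      then have "?Q s1"
        using X best same by (auto simp: best_def seen_def)
      then show "reaches Skip s1 (1 + (1 + (m * 3 + 2))) ?Q"
        by (intro reaches_mono[OF reaches_Skip]) auto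
    qed
  qed
  then show ?thesis
    by (rule reaches_mono) (auto simp: step_time_def n_def m_def algebra_simps)
qed

text \<open>The thresholds are read from the initial state, whose cost arrays are never overwritten,
  so the invariants of both loops speak of the same pairs throughout. \<open>best\<close> holds
  vacuously at the start.\<close>

lemma reaches_solver:
  assumes pres: "presents I s" and found: "var s ''found'' = 0"
  defines "n \<equiv> var s ''n''" and "m \<equiv> var s ''m''"
  shows "reaches (solver ver) s (Suc m * ((Suc m * (step_time n m + 2) + 2) + 2) + 2)
    (\<lambda>s'. best ver I s' \<and> (\<forall>k\<le>m. \<forall>l\<le>m. seen ver I s' (rarr s ''c'' k) (rarr s ''d'' l)))"
proof -
  let ?step = "Seq (candidate ver) record_candidate"
  let ?inner = "for_loop ''j'' (Plus (Var ''m'') (Num 1)) ?step"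
  let ?seen = "\<lambda>s' k l. seen ver I s' (rarr s ''c'' k) (rarr s ''d'' l)"
  have "reaches (solver ver) s (Suc m * ((Suc m * (step_time n m + 2) + 2) + 2) + 2)
    (\<lambda>s'. best ver I s' \<and> (\<forall>k<Suc m. \<forall>l<Suc m. ?seen s' k l))"
    unfolding solver_def
  proof (rule reaches_for_loop[where J = "\<lambda>i s'. best ver I s' \<and> (\<forall>k<i. \<forall>l<Suc m. ?seen s' k l)"],
      fold solver_def)
    show "best ver I (s\<lparr>var := (var s)(''i'' := 0)\<rparr>) \<and>
      (\<forall>k<0. \<forall>l<Suc m. ?seen (s\<lparr>var := (var s)(''i'' := 0)\<rparr>) k l)"
      using found by (simp add: best_def)
  next
    fix s' assume "frame (solver ver) s s'"
    from frame_var[OF this, of "''m''"] show "nval (Plus (Var ''m'') (Num 1)) s' = Suc m"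
      by (simp add: solver_def m_def)
  next
    fix i s1 assume i: "i < Suc m" "var s1 ''i'' = i" and fr1: "frame (solver ver) s s1"
      and J1: "best ver I s1 \<and> (\<forall>k<i. \<forall>l<Suc m. ?seen s1 k l)"
    have pres1: "presents I s1" and nm1: "var s1 ''n'' = n" "var s1 ''m'' = m"
        and c1: "rarr s1 ''c'' = rarr s ''c''" "rarr s1 ''d'' = rarr s ''d''"
      using presents_frame[OF fr1 pres] frame_var[OF fr1] frame_rarr[OF fr1]
      by (auto simp: solver_def n_def m_def)
    have "reaches ?inner s1 (Suc m * (step_time n m + 2) + 2) (\<lambda>s'. best ver I s' \<and>
      (\<forall>k<i. \<forall>l<Suc m. ?seen s' k l) \<and> (\<forall>l<Suc m. ?seen s' i l))"
    proof (rule reaches_for_loop[where J = "\<lambda>j s'. best ver I s' \<and>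
        (\<forall>k<i. \<forall>l<Suc m. ?seen s' k l) \<and> (\<forall>l<j. ?seen s' i l)"])
      fix s' assume "frame ?inner s1 s'"
      from frame_var[OF this, of "''m''"] show "nval (Plus (Var ''m'') (Num 1)) s' = Suc m"
        by (simp add: nm1)
    next
      fix j s2 assume j: "j < Suc m" "var s2 ''j'' = j" and fr2: "frame ?inner s1 s2"
        and J2: "best ver I s2 \<and> (\<forall>k<i. \<forall>l<Suc m. ?seen s2 k l) \<and> (\<forall>l<j. ?seen s2 i l)"
      have pres2: "presents I s2" and nm2: "var s2 ''n'' = n" "var s2 ''m'' = m" "var s2 ''i'' = i"
          and c2: "rarr s2 ''c'' = rarr s ''c''" "rarr s2 ''d'' = rarr s ''d''"
        using presents_frame[OF fr2 pres1] frame_var[OF fr2] frame_rarr[OF fr2] i nm1 c1 by auto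
      have "reaches ?step s2 (step_time n m) (\<lambda>s'. best ver I s' \<and> ?seen s' i j \<and>
          (\<forall>L' b'. seen ver I s2 L' b' \<longrightarrow> seen ver I s' L' b'))"
        using reaches_step[OF pres2, of ver] J2 i j nm2 c2 by simp
      then show "reaches ?step s2 (step_time n m) (\<lambda>s'. var s' ''j'' = j \<and>
        best ver I (s'\<lparr>var := (var s')(''j'' := Suc j)\<rparr>) \<and>
        (\<forall>k<i. \<forall>l<Suc m. ?seen (s'\<lparr>var := (var s')(''j'' := Suc j)\<rparr>) k l) \<and>
        (\<forall>l<Suc j. ?seen (s'\<lparr>var := (var s')(''j'' := Suc j)\<rparr>) i l))"
      proof (rule reaches_mono[OF _ order_refl])
        fix s' assume fr: "frame ?step s2 s'" and Q: "best ver I s' \<and> ?seen s' i j \<and>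
          (\<forall>L' b'. seen ver I s2 L' b' \<longrightarrow> seen ver I s' L' b')"
        show "var s' ''j'' = j \<and>
          best ver I (s'\<lparr>var := (var s')(''j'' := Suc j)\<rparr>) \<and>
          (\<forall>k<i. \<forall>l<Suc m. ?seen (s'\<lparr>var := (var s')(''j'' := Suc j)\<rparr>) k l) \<and>
          (\<forall>l<Suc j. ?seen (s'\<lparr>var := (var s')(''j'' := Suc j)\<rparr>) i l)"
          using frame_var[OF fr, of "''j''"] J2 Q j(2) by (auto simp: less_Suc_eq)
      qed
    qed (use J1 in simp)
    then show "reaches ?inner s1 (Suc m * (step_time n m + 2) + 2) (\<lambda>s'. var s' ''i'' = i \<and>
      best ver I (s'\<lparr>var := (var s')(''i'' := Suc i)\<rparr>) \<and>
      (\<forall>k<Suc i. \<forall>l<Suc m. ?seen (s'\<lparr>var := (var s')(''i'' := Suc i)\<rparr>) k l))"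
    proof (rule reaches_mono[OF _ order_refl])
      fix s' assume fr: "frame ?inner s1 s'" and Q: "best ver I s' \<and>
        (\<forall>k<i. \<forall>l<Suc m. ?seen s' k l) \<and> (\<forall>l<Suc m. ?seen s' i l)"
      show "var s' ''i'' = i \<and> best ver I (s'\<lparr>var := (var s')(''i'' := Suc i)\<rparr>) \<and>
        (\<forall>k<Suc i. \<forall>l<Suc m. ?seen (s'\<lparr>var := (var s')(''i'' := Suc i)\<rparr>) k l)"
        using frame_var[OF fr, of "''i''"] Q i(2) by (simp add: less_Suc_eq)
    qed
  qed
  then show ?thesis
    by (simp only: less_Suc_eq_le)
qed

section \<open>Running time and correctness of the output\<close>

lemma solver_time_le:
  "Suc m * ((Suc m * (step_time n m + 2) + 2) + 2) + 2 \<le> 64 * (1 + (n + m)) ^ 4"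
proof -
  define S where "S = 1 + (n + m)"
  have S: "1 \<le> S" "m \<le> S" "n \<le> S" "Suc m \<le> S"
    by (auto simp: S_def)
  have sq: "S \<le> S * S" "1 \<le> S * S"
    using S(1) by (auto simp: Suc_le_eq)
  have "m * n \<le> S * S"
    using S by (intro mult_le_mono) auto
  \<comment> \<open>All terms are bounded by multiples of \<open>S * S\<close>, and 8 + 7 + 25 + 16
    + 2 = 58. The constants of the two loops then add 4 and 2, which gives 64.\<close>
  then have "step_time n m + 2 \<le> 58 * (S * S)"
    using S sq unfolding step_time_def by linarith
  then have "Suc m * (step_time n m + 2) \<le> S * (58 * (S * S))"
    using S by (intro mult_le_mono) auto
  moreover have "1 \<le> S * (S * S)"
    using S(1) by (simp add: Suc_le_eq)
  ultimately have "Suc m * (step_time n m + 2) + 2 + 2 \<le> 62 * (S * (S * S))"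
    by linarith
  then have "Suc m * (Suc m * (step_time n m + 2) + 2 + 2) \<le> S * (62 * (S * (S * S)))"
    using S by (intro mult_le_mono) auto
  moreover have "1 \<le> S * (S * (S * S))"
    using S(1) by (simp add: Suc_le_eq)
  ultimately have "Suc m * (Suc m * (step_time n m + 2) + 2 + 2) + 2 \<le> 64 * (S * (S * (S * S)))"
    by linarith
  then show ?thesis
    unfolding S_def[symmetric] by (simp only: power4_eq_xxxx mult.assoc)
qed

lemma encodes_presents:
  assumes "bmst_instance I" "bmst_encodes I s"
  shows "presents I s" "var s ''found'' = 0"
  using assms by (auto simp: bmst_encodes_def presents_def edges_def)

text \<open>The stored value is at most the optimum, by \<open>seen\<close> at the thresholds of an
  optimal choice, and at least the value of the stored choice, by \<open>best\<close>. Hence all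
  three coincide.\<close>

lemma solved_if_all_seen:
  assumes pres: "presents I s" and best: "best ver I s'"
    and seen: "\<forall>k\<le>var s ''m''. \<forall>l\<le>var s ''m''. seen ver I s' (rarr s ''c'' k) (rarr s ''d'' l)"
  shows "bmst_solves ver I s'"
proof -
  have inst: "bmst_instance I"
    using pres by (simp add: presents_def)
  \<comment> \<open>The threshold 0 is found at index m, just past the edges.\<close>
  have c: "\<exists>k\<le>var s ''m''. rarr s ''c'' k = x" if "x \<in> insert 0 (leader_cost I ` edges I)" for x
    using that pres unfolding presents_def by (auto intro: less_imp_le)
  have d: "\<exists>k\<le>var s ''m''. rarr s ''d'' k = x" if "x \<in> insert 0 (follower_cost I ` edges I)" for x
    using that pres unfolding presents_def by (auto intro: less_imp_le)
  obtain Z where Z: "pessimistic_optimum ver I Z"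
    using pessimistic_optimum_exists[OF inst] by blast
  then have feasZ: "feasible I Z" and minZ: "\<And>X. feasible I X \<Longrightarrow> pessimistic_value ver I Z \<le> pessimistic_value ver I X"
    by (auto simp: pessimistic_optimum_def is_arg_min_linorder)
  have "0 < var s' ''found'' \<and> rarr s' ''value'' 0 \<le> pessimistic_value ver I Z"
    using optimum_accepted[OF inst feasZ, of ver] seen c d unfolding seen_def by metis
  moreover from this obtain X where X: "feasible I X" "pessimistic_value ver I X \<le> rarr s' ''value'' 0"
      "\<forall>e\<in>edges I. arr s' ''X'' e = (if e \<in> X then 1 else 0)"
    using best unfolding best_def by blast
  ultimately have "pessimistic_value ver I X = pessimistic_value ver I Z" "rarr s' ''value'' 0 = pessimistic_value ver I X"
    using minZ[OF X(1)] by auto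
  moreover from this have "pessimistic_optimum ver I X"
    using X(1) minZ by (auto simp: pessimistic_optimum_def is_arg_min_linorder)
  ultimately show ?thesis
    using X(3) unfolding bmst_solves_def by blast
qed

theorem theorem10:
  "\<forall>ver :: follower_version.
     poly_time_solvable {I :: (nat, nat) bmst. bmst_instance I}
       bmst_size bmst_encodes (bmst_solves ver)"
proof
  fix ver :: follower_version
  show "poly_time_solvable {I :: (nat, nat) bmst. bmst_instance I}
    bmst_size bmst_encodes (bmst_solves ver)"
    unfolding poly_time_solvable_def
  \<comment> \<open>The polynomial is 64 times the fourth power of 1 + x.\<close>
  proof (intro exI[of _ "solver ver"] exI[of _ "[:64:] * [:1, 1:] ^ 4"] ballI allI impI)
    fix I :: "(nat, nat) bmst" and s
    assume "I \<in> {I. bmst_instance I}" and enc: "bmst_encodes I s"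
    then have pres: "presents I s" and found: "var s ''found'' = 0"
      using encodes_presents by blast+
    obtain t s' where t: "runs (solver ver) s t s'"
        "t \<le> Suc (var s ''m'') * ((Suc (var s ''m'') * (step_time (var s ''n'') (var s ''m'') + 2) + 2) + 2) + 2"
        "best ver I s'" "\<forall>k\<le>var s ''m''. \<forall>l\<le>var s ''m''. seen ver I s' (rarr s ''c'' k) (rarr s ''d'' l)"
      using reaches_solver[OF pres found, of ver] unfolding reaches_def by blast
    have "bmst_size I = var s ''n'' + var s ''m''"
      using pres by (simp add: bmst_size_def presents_def)
    then have "t \<le> poly ([:64:] * [:1, 1:] ^ 4) (bmst_size I)"
      using t(2) solver_time_le[of "var s ''m''" "var s ''n''"] by (simp add: poly_power)
    then show "\<exists>t s'. runs (solver ver) s t s' \<and> t \<le> poly ([:64:] * [:1, 1:] ^ 4) (bmst_size I) \<and>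
        bmst_solves ver I s'"
      using t(1) solved_if_all_seen[OF pres t(3,4)] by blast
  qed
qed

end
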